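(* Let $(g,\mu,J)$ be a driven cofactor system in adapted coordinates $(y^i,x^a)$, with $J$ and $J_1$ nonsingular. Let $\bar J_2$ be the type $(1,1)$ tensor with components $\bar J_2{}^a_b=J^a_b-J^a_i(J_1^{-1})^i_jJ^j_b$. Then, regarding the $y^i$ as external parameters, $\bar J_2$ is a (parameter-dependent) special conformal Killing tensor for the metric $g_2=g_{ab}(x)\,dx^a\otimes dx^b$; and its cofactor tensor is $(\det J_1)^{-1}A_2$, where $A=\operatorname{cof}J$ and $A_2=P_2\circ A\circ P_2$ (restricted to $K$).
   Context: Everything is smooth and the summation convention is used. Special conformal Killing tensor (scKt) for a Riemannian metric $g$: a type $(1,1)$ tensor field $J$, symmetric with respect to $g$, with $J_{\alpha\beta|\gamma}=\frac12(\alpha_\alpha g_{\beta\gamma}+\alpha_\beta g_{\alpha\gamma})$, where $J_{\alpha\beta}=g_{\alpha\gamma}J^\gamma_\beta$, the bar is the Levi-Civita covariant derivative of $g$, and (necessarily) $\alpha=d(\operatorname{tr}J)$. For the parameter-dependent tensor $\bar J_2$ these conditions are imposed, for each fixed $y$, on the space of the $x^a$ with metric $g_2$ and derivatives with respect to the $x^a$ only. The cofactor tensor $\operatorname{cof}J$ of $J$ is defined by $J(\operatorname{cof}J)=(\operatorname{cof}J)J=(\det J)I$ (in general: the adjugate). $J$ acts on 1-forms by its adjoint. $d_J$ is the degree 1 derivation of forms anticommuting with $d$ with $d_Jf=J(df)$ on functions, and $D_J\rho=d_J\rho+d(\operatorname{tr}J)\wedge\rho$. A cofactor system $(g,\mu,J)$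 consists of a Riemannian metric $g$, a 1-form $\mu$ and a nonsingular scKt $J$ for $g$ with $D_J\mu=0$; it represents the equations $\frac{d}{dt}(\partial T/\partial\dot q^\alpha)-\partial T/\partial q^\alpha=Q_\alpha$, with $T=\frac12g_{\alpha\beta}\dot q^\alpha\dot q^\beta$, $\mu=Q_\alpha dq^\alpha$. Driven cofactor system in adapted coordinates: a cofactor system on a manifold of dimension $N=m+n$ with coordinates $(y^i,x^a)$, $i=1,\dots,m$, $a=1,\dots,n$, such that $g=g_{ij}(y)dy^i\otimes dy^j+g_{ab}(x)dx^a\otimes dx^b$ (no mixed terms) and $\mu=\mu_1+\mu_2$ with $\mu_1=Q_i(y)dy^i$, $\mu_2=Q_a(x,y)dx^a$, $Q_a=-\partial V/\partial x^a$ for a function $V(x,y)$, and the $\partial Q_a/\partial y^i$ are not all zero. $K=\mathrm{span}\{\partial/\partial x^a\}$, $K^\perp=\mathrm{span}\{\partial/\partial y^i\}$, and $P_1,P_2$ are the complementary projectors onto $K^\perp$ and $K$ respectively. $J_1=P_1JP_1$ has components $J^i_j$; "nonsingular", inverses, determinants and cofactors of $J_1$ (resp. $\bar J_2$) refer to its restriction to $K^\perp$ (resp. $K$). *)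

theory Defs
  imports "HOL-Analysis.Analysis"
begin

text \<open>
  Tensor fields on a coordinate domain \<open>U\<close> are given by their component functions on an open
  subset of \<open>real ^ 'k\<close>. For a (1,1) tensor, \<open>J z $ \<alpha> $ \<beta>\<close> is \<open>J\<^sup>\<alpha>\<^sub>\<beta>\<close> (upper index = row), so that
  composition of endomorphisms is the matrix product. For covariant 2-tensors,
  \<open>g z $ \<alpha> $ \<beta>\<close> is \<open>g\<^sub>\<alpha>\<^sub>\<beta>\<close>.
\<close>

definition partial :: "'k::finite \<Rightarrow> (real^'k \<Rightarrow> real) \<Rightarrow> real^'k \<Rightarrow> real" where
  "partial k f z = frechet_derivative f (at z) (axis k 1)"

primrec Ck_on :: "nat \<Rightarrow> (real^'k::finite \<Rightarrow> real) \<Rightarrow> (real^'k) set \<Rightarrow> bool" where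
  "Ck_on 0 f U \<longleftrightarrow> continuous_on U f"
| "Ck_on (Suc r) f U \<longleftrightarrow> (\<forall>z\<in>U. f differentiable (at z)) \<and> (\<forall>k. Ck_on r (partial k f) U)"

definition smooth_on :: "(real^'k::finite) set \<Rightarrow> (real^'k \<Rightarrow> real) \<Rightarrow> bool" where
  "smooth_on U f \<longleftrightarrow> (\<forall>r. Ck_on r f U)"

definition smooth_form_on :: "(real^'k::finite) set \<Rightarrow> (real^'k \<Rightarrow> real^'k) \<Rightarrow> bool" where
  "smooth_form_on U \<mu> \<longleftrightarrow> (\<forall>\<alpha>. smooth_on U (\<lambda>z. \<mu> z $ \<alpha>))"

definition smooth_tensor_on :: "(real^'k::finite) set \<Rightarrow> (real^'k \<Rightarrow> real^'k^'k) \<Rightarrow> bool" where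
  "smooth_tensor_on U T \<longleftrightarrow> (\<forall>\<alpha> \<beta>. smooth_on U (\<lambda>z. T z $ \<alpha> $ \<beta>))"


subsection \<open>Differential forms of degree at most 2\<close>

definition d0 :: "(real^'k::finite \<Rightarrow> real) \<Rightarrow> real^'k \<Rightarrow> real^'k" where
  "d0 f z = (\<chi> \<alpha>. partial \<alpha> f z)"

text \<open>
  A 2-form is represented by its antisymmetric component matrix \<open>\<omega>\<^sub>\<alpha>\<^sub>\<beta> = \<omega>(\<partial>\<^sub>\<alpha>, \<partial>\<^sub>\<beta>)\<close>.
\<close>

definition d1 :: "(real^'k::finite \<Rightarrow> real^'k) \<Rightarrow> real^'k \<Rightarrow> real^'k^'k" where
  "d1 \<rho> z = (\<chi> \<alpha> \<beta>. partial \<alpha> (\<lambda>w. \<rho> w $ \<beta>) z - partial \<beta> (\<lambda>w. \<rho> w $ \<alpha>) z)"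

definition wedge :: "real^'k::finite \<Rightarrow> real^'k \<Rightarrow> real^'k^'k" where
  "wedge \<rho> \<sigma> = (\<chi> \<alpha> \<beta>. \<rho> $ \<alpha> * \<sigma> $ \<beta> - \<rho> $ \<beta> * \<sigma> $ \<alpha>)"

text \<open>The adjoint action \<open>(J \<rho>)\<^sub>\<beta> = J\<^sup>\<alpha>\<^sub>\<beta> \<rho>\<^sub>\<alpha>\<close> on 1-forms.\<close>

definition adj_act :: "real^'k^'k \<Rightarrow> real^'k \<Rightarrow> real^'k::finite" where
  "adj_act J \<rho> = transpose J *v \<rho>"

definition dJ0 :: "(real^'k::finite \<Rightarrow> real^'k^'k) \<Rightarrow> (real^'k \<Rightarrow> real) \<Rightarrow> real^'k \<Rightarrow> real^'k" where
  "dJ0 J f z = adj_act (J z) (d0 f z)"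

text \<open>
  \<open>d\<^sub>J\<close> on 1-forms. A degree 1 derivation anticommuting with \<open>d\<close> must satisfy
  \<open>d\<^sub>J (\<rho>\<^sub>\<alpha> dq\<^sup>\<alpha>) = d\<^sub>J \<rho>\<^sub>\<alpha> \<and> dq\<^sup>\<alpha> + \<rho>\<^sub>\<alpha> d\<^sub>J dq\<^sup>\<alpha>\<close> with \<open>d\<^sub>J dq\<^sup>\<alpha> = - d (d\<^sub>J q\<^sup>\<alpha>)\<close>,
  and this is taken as the definition.
\<close>

definition dJ1 :: "(real^'k::finite \<Rightarrow> real^'k^'k) \<Rightarrow> (real^'k \<Rightarrow> real^'k) \<Rightarrow> real^'k \<Rightarrow> real^'k^'k" where
  "dJ1 J \<rho> z = (\<Sum>\<alpha>\<in>UNIV. wedge (dJ0 J (\<lambda>w. \<rho> w $ \<alpha>) z) (axis \<alpha> 1)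
                        - \<rho> z $ \<alpha> *\<^sub>R d1 (dJ0 J (\<lambda>w. w $ \<alpha>)) z)"

definition DJ1 :: "(real^'k::finite \<Rightarrow> real^'k^'k) \<Rightarrow> (real^'k \<Rightarrow> real^'k) \<Rightarrow> real^'k \<Rightarrow> real^'k^'k" where
  "DJ1 J \<rho> z = dJ1 J \<rho> z + wedge (d0 (\<lambda>w. trace (J w)) z) (\<rho> z)"


subsection \<open>Metrics, special conformal Killing tensors, cofactor systems\<close>

definition riemannian_metric_on :: "(real^'k::finite) set \<Rightarrow> (real^'k \<Rightarrow> real^'k^'k) \<Rightarrow> bool" where
  "riemannian_metric_on U g \<longleftrightarrow>
     open U \<and> smooth_tensor_on U g \<and>
     (\<forall>z\<in>U. transpose (g z) = g z \<and> (\<forall>v. v \<noteq> 0 \<longrightarrow> v \<bullet> (g z *v v) > 0))"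

text \<open>\<open>christoffel g \<delta> \<alpha> \<beta>\<close> is \<open>\<Gamma>\<^sup>\<delta>\<^sub>\<alpha>\<^sub>\<beta>\<close>, with upper index first.\<close>

definition christoffel :: "(real^'k::finite \<Rightarrow> real^'k^'k) \<Rightarrow> 'k \<Rightarrow> 'k \<Rightarrow> 'k \<Rightarrow> real^'k \<Rightarrow> real" where
  "christoffel g \<delta> \<alpha> \<beta> z =
     (\<Sum>\<epsilon>\<in>UNIV. matrix_inv (g z) $ \<delta> $ \<epsilon> *
        (partial \<alpha> (\<lambda>w. g w $ \<epsilon> $ \<beta>) z + partial \<beta> (\<lambda>w. g w $ \<epsilon> $ \<alpha>) z
          - partial \<epsilon> (\<lambda>w. g w $ \<alpha> $ \<beta>) z)) / 2"

text \<open>\<open>cov_deriv2 g T \<alpha> \<beta> \<gamma>\<close> is \<open>T\<^sub>\<alpha>\<^sub>\<beta>\<^sub>|\<^sub>\<gamma>\<close> for a covariant 2-tensor \<open>T\<close>.\<close>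

definition cov_deriv2 ::
  "(real^'k::finite \<Rightarrow> real^'k^'k) \<Rightarrow> (real^'k \<Rightarrow> real^'k^'k) \<Rightarrow> 'k \<Rightarrow> 'k \<Rightarrow> 'k \<Rightarrow> real^'k \<Rightarrow> real" where
  "cov_deriv2 g T \<alpha> \<beta> \<gamma> z =
     partial \<gamma> (\<lambda>w. T w $ \<alpha> $ \<beta>) z
     - (\<Sum>\<delta>\<in>UNIV. christoffel g \<delta> \<gamma> \<alpha> z * T z $ \<delta> $ \<beta>)
     - (\<Sum>\<delta>\<in>UNIV. christoffel g \<delta> \<gamma> \<beta> z * T z $ \<alpha> $ \<delta>)"

definition sckt_on ::
  "(real^'k::finite) set \<Rightarrow> (real^'k \<Rightarrow> real^'k^'k) \<Rightarrow> (real^'k \<Rightarrow> real^'k^'k) \<Rightarrow> bool" where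
  "sckt_on U g J \<longleftrightarrow>
     riemannian_metric_on U g \<and> smooth_tensor_on U J \<and>
     (\<forall>z\<in>U. transpose (g z ** J z) = g z ** J z) \<and>
     (\<forall>z\<in>U. \<forall>\<alpha> \<beta> \<gamma>.
        cov_deriv2 g (\<lambda>w. g w ** J w) \<alpha> \<beta> \<gamma> z =
          (d0 (\<lambda>w. trace (J w)) z $ \<alpha> * g z $ \<beta> $ \<gamma>
           + d0 (\<lambda>w. trace (J w)) z $ \<beta> * g z $ \<alpha> $ \<gamma>) / 2)"

definition cofactor_system ::
  "(real^'k::finite) set \<Rightarrow> (real^'k \<Rightarrow> real^'k^'k) \<Rightarrow> (real^'k \<Rightarrow> real^'k) \<Rightarrow> (real^'k \<Rightarrow> real^'k^'k) \<Rightarrow> bool" where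
  "cofactor_system U g \<mu> J \<longleftrightarrow>
     riemannian_metric_on U g \<and> smooth_form_on U \<mu> \<and> sckt_on U g J \<and>
     (\<forall>z\<in>U. det (J z) \<noteq> 0) \<and> (\<forall>z\<in>U. DJ1 J \<mu> z = 0)"

text \<open>
  The adjugate: entry \<open>(k, l)\<close> is the determinant of \<open>A\<close> with column \<open>k\<close> replaced by the
  \<open>l\<close>-th unit vector, i.e. the \<open>(l, k)\<close> signed minor of \<open>A\<close>.
\<close>

definition cof :: "real^'k^'k \<Rightarrow> real^'k^'k::finite" where
  "cof A = (\<chi> k l. det (\<chi> i j. if j = k then (if i = l then 1 else 0) else A $ i $ j))"


subsection \<open>Adapted coordinates\<close>

text \<open>
  Coordinates \<open>(y\<^sup>i, x\<^sup>a)\<close> are indexed by \<open>'m + 'n\<close>: \<open>z $ Inl i\<close> is \<open>y\<^sup>i\<close> and \<open>z $ Inr a\<close> is \<open>x\<^sup>a\<close>.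
\<close>

definition y_part :: "real^('m::finite + 'n::finite) \<Rightarrow> real^'m" where
  "y_part z = (\<chi> i. z $ Inl i)"

definition x_part :: "real^('m::finite + 'n::finite) \<Rightarrow> real^'n" where
  "x_part z = (\<chi> a. z $ Inr a)"

definition join :: "real^'m \<Rightarrow> real^'n \<Rightarrow> real^('m::finite + 'n::finite)" where
  "join y x = (\<chi> \<alpha>. case \<alpha> of Inl i \<Rightarrow> y $ i | Inr a \<Rightarrow> x $ a)"

definition driven_cofactor_system ::
  "(real^('m::finite + 'n::finite)) set \<Rightarrow>
   (real^'m \<Rightarrow> real^'m^'m) \<Rightarrow> (real^'n \<Rightarrow> real^'n^'n) \<Rightarrow>
   (real^('m + 'n) \<Rightarrow> real^('m + 'n)^('m + 'n)) \<Rightarrow>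
   (real^('m + 'n) \<Rightarrow> real^('m + 'n)) \<Rightarrow>
   (real^('m + 'n) \<Rightarrow> real^('m + 'n)^('m + 'n)) \<Rightarrow> bool" where
  "driven_cofactor_system U g1 g2 g \<mu> J \<longleftrightarrow>
     cofactor_system U g \<mu> J \<and>
     (\<forall>z\<in>U. (\<forall>i j. g z $ Inl i $ Inl j = g1 (y_part z) $ i $ j) \<and>
             (\<forall>a b. g z $ Inr a $ Inr b = g2 (x_part z) $ a $ b) \<and>
             (\<forall>i a. g z $ Inl i $ Inr a = 0 \<and> g z $ Inr a $ Inl i = 0)) \<and>
     (\<exists>Q1 :: real^'m \<Rightarrow> real^'m. \<forall>z\<in>U. \<forall>i. \<mu> z $ Inl i = Q1 (y_part z) $ i) \<and>
     (\<exists>V. smooth_on U V \<and> (\<forall>z\<in>U. \<forall>a. \<mu> z $ Inr a = - partial (Inr a) V z)) \<and>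
     (\<exists>z\<in>U. \<exists>i a. partial (Inl i) (\<lambda>w. \<mu> w $ Inr a) z \<noteq> 0)"

text \<open>\<open>P1\<close> projects onto \<open>K\<^sup>\<bottom> = span {\<partial>/\<partial>y\<^sup>i}\<close> and \<open>P2\<close> onto \<open>K = span {\<partial>/\<partial>x\<^sup>a}\<close>.\<close>

definition P1 :: "real^('m::finite + 'n::finite)^('m + 'n)" where
  "P1 = (\<chi> \<alpha> \<beta>. if \<alpha> = \<beta> \<and> \<alpha> \<in> range Inl then 1 else 0)"

definition P2 :: "real^('m::finite + 'n::finite)^('m + 'n)" where
  "P2 = (\<chi> \<alpha> \<beta>. if \<alpha> = \<beta> \<and> \<alpha> \<in> range Inr then 1 else 0)"

text \<open>
  Matrix of the restriction to \<open>K\<^sup>\<bottom>\<close> (resp. \<open>K\<close>), in the coordinate basis, of an endomorphism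
  that maps \<open>K\<^sup>\<bottom>\<close> (resp. \<open>K\<close>) into itself; used for \<open>P1 J P1\<close> and \<open>P2 A P2\<close> only.
\<close>

definition restrict_Kperp :: "real^('m::finite + 'n::finite)^('m + 'n) \<Rightarrow> real^'m^'m" where
  "restrict_Kperp T = (\<chi> i j. T $ Inl i $ Inl j)"

definition restrict_K :: "real^('m::finite + 'n::finite)^('m + 'n) \<Rightarrow> real^'n^'n" where
  "restrict_K T = (\<chi> a b. T $ Inr a $ Inr b)"

definition J1 :: "real^('m::finite + 'n::finite)^('m + 'n) \<Rightarrow> real^'m^'m" where
  "J1 J = restrict_Kperp (P1 ** J ** P1)"

definition J2bar :: "real^('m::finite + 'n::finite)^('m + 'n) \<Rightarrow> real^'n^'n" where
  "J2bar J = (\<chi> a b. J $ Inr a $ Inr b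
     - (\<Sum>i\<in>UNIV. \<Sum>j\<in>UNIV. J $ Inr a $ Inl i * matrix_inv (J1 J) $ i $ j * J $ Inl j $ Inr b))"


subsection \<open>The defining properties of \<open>cof\<close> and of \<open>d\<^sub>J\<close> on 1-forms\<close>

lemma cof_mult_left: "cof A ** A = det A *\<^sub>R mat 1"
proof -
  have lin: "det (\<chi> i j. if j = k then v $ i else A $ i $ j) = (\<Sum>l\<in>UNIV. cof A $ k $ l * v $ l)" for k v
  proof -
    have "det (\<chi> i j. if j = k then v $ i else A $ i $ j)
        = det (transpose (\<chi> i j. if j = k then v $ i else A $ i $ j))"
      by simp
    also have "transpose (\<chi> i j. if j = k then v $ i else A $ i $ j)
        = (\<chi> i. if i = k then (\<Sum>l\<in>UNIV. v $ l *s axis l 1) else column i A)"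
      by (auto simp: vec_eq_iff transpose_def column_def axis_def if_distrib[of "\<lambda>t. _ * t"] cong: if_cong)
    also have "det \<dots> = (\<Sum>l\<in>UNIV. det (\<chi> i. if i = k then v $ l *s axis l 1 else column i A))"
      by (rule det_linear_row_sum) simp
    also have "\<dots> = (\<Sum>l\<in>UNIV. v $ l * det (\<chi> i. if i = k then axis l 1 else column i A))"
      by (simp add: det_row_mul)
    also have "\<dots> = (\<Sum>l\<in>UNIV. cof A $ k $ l * v $ l)"
    proof (rule sum.cong)
      fix l
      have "(\<chi> i. if i = k then axis l 1 else column i A)
          = transpose (\<chi> i j. if j = k then (if i = l then 1 else 0) else A $ i $ j)"
        by (auto simp: vec_eq_iff transpose_def column_def axis_def)
      then show "v $ l * det (\<chi> i. if i = k then axis l 1 else column i A) = cof A $ k $ l * v $ l"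
        by (simp add: cof_def)
    qed simp
    finally show ?thesis .
  qed
  have "(cof A ** A) $ k $ p = (det A *\<^sub>R mat 1) $ k $ p" for k p
  proof -
    have "(cof A ** A) $ k $ p = det (\<chi> i j. if j = k then (A *v axis p 1) $ i else A $ i $ j)"
      using lin[of k "column p A"]
      by (simp add: matrix_matrix_mult_def matrix_vector_mult_basis cong: if_cong) (simp add: column_def cong: if_cong)
    also have "\<dots> = (det A *\<^sub>R mat 1) $ k $ p"
      by (subst cramer_lemma) (simp add: mat_def axis_def)
    finally show ?thesis .
  qed
  then show ?thesis by (simp add: vec_eq_iff)
qed

lemma cof_mult_right:
  assumes "det A \<noteq> 0"
  shows "A ** cof A = det A *\<^sub>R mat 1"
proof -
  have "(inverse (det A) *\<^sub>R cof A) ** A = mat 1"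
    using assms by (simp add: scalar_matrix_assoc[symmetric] cof_mult_left)
  then have "A ** (inverse (det A) *\<^sub>R cof A) = mat 1"
    using matrix_left_right_inverse by blast
  then have "inverse (det A) *\<^sub>R (A ** cof A) = mat 1"
    by (simp add: matrix_scalar_ac scalar_matrix_assoc)
  then have "det A *\<^sub>R (inverse (det A) *\<^sub>R (A ** cof A)) = det A *\<^sub>R mat 1"
    by simp
  then show ?thesis using assms by simp
qed

lemma partial_add:
  assumes "f differentiable at z" "h differentiable at z"
  shows "partial k (\<lambda>w. f w + h w) z = partial k f z + partial k h z"
proof -
  have "((\<lambda>w. f w + h w) has_derivative
      (\<lambda>v. frechet_derivative f (at z) v + frechet_derivative h (at z) v)) (at z)"
    using assms by (intro has_derivative_add) (auto simp: frechet_derivative_works)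
  from frechet_derivative_at[OF this, symmetric] show ?thesis
    by (simp add: partial_def)
qed

lemma partial_mult:
  fixes f h :: "real^'k::finite \<Rightarrow> real"
  assumes "f differentiable at z" "h differentiable at z"
  shows "partial k (\<lambda>w. f w * h w) z = f z * partial k h z + h z * partial k f z"
proof -
  have "((\<lambda>w. f w * h w) has_derivative
      (\<lambda>v. f z * frechet_derivative h (at z) v + frechet_derivative f (at z) v * h z)) (at z)"
    using assms by (intro has_derivative_mult) (auto simp: frechet_derivative_works)
  from frechet_derivative_at[OF this, symmetric] show ?thesis
    by (simp add: partial_def)
qed

lemma partial_const: "partial k (\<lambda>w. c) z = 0"
  by (simp add: partial_def)

lemma dJ1_add:
  assumes "\<And>\<alpha>. (\<lambda>w. \<rho> w $ \<alpha>) differentiable at z" "\<And>\<alpha>. (\<lambda>w. \<sigma> w $ \<alpha>) differentiable at z"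
  shows "dJ1 J (\<lambda>w. \<rho> w + \<sigma> w) z = dJ1 J \<rho> z + dJ1 J \<sigma> z"
proof -
  have a: "dJ0 J (\<lambda>w. \<rho> w $ \<alpha> + \<sigma> w $ \<alpha>) z = dJ0 J (\<lambda>w. \<rho> w $ \<alpha>) z + dJ0 J (\<lambda>w. \<sigma> w $ \<alpha>) z" for \<alpha>
    using assms
    by (simp add: dJ0_def d0_def adj_act_def partial_add vec_eq_iff matrix_vector_mult_def
        algebra_simps sum.distrib)
  have b: "wedge (a + b) c = wedge a c + wedge b c" for a b c :: "real^'b"
    by (simp add: wedge_def vec_eq_iff algebra_simps)
  show ?thesis
    by (simp add: dJ1_def a b sum.distrib[symmetric] algebra_simps)
qed

lemma dJ1_leibniz:
  assumes "f differentiable at z" "\<And>\<alpha>. (\<lambda>w. \<rho> w $ \<alpha>) differentiable at z"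
  shows "dJ1 J (\<lambda>w. f w *\<^sub>R \<rho> w) z = wedge (dJ0 J f z) (\<rho> z) + f z *\<^sub>R dJ1 J \<rho> z"
proof -
  have a: "dJ0 J (\<lambda>w. f w * \<rho> w $ \<alpha>) z = f z *\<^sub>R dJ0 J (\<lambda>w. \<rho> w $ \<alpha>) z + \<rho> z $ \<alpha> *\<^sub>R dJ0 J f z" for \<alpha>
    using assms
    by (simp add: dJ0_def d0_def adj_act_def partial_mult vec_eq_iff matrix_vector_mult_def
        algebra_simps sum.distrib sum_distrib_left)
  have b: "wedge (s *\<^sub>R a + t *\<^sub>R b) c = s *\<^sub>R wedge a c + t *\<^sub>R wedge b c" for a b c :: "real^'b" and s t
    by (simp add: wedge_def vec_eq_iff algebra_simps)
  have c: "(\<Sum>\<alpha>\<in>UNIV. v $ \<alpha> *\<^sub>R wedge u (axis \<alpha> 1)) = wedge u v" for u v :: "real^'b"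
    by (simp add: wedge_def vec_eq_iff algebra_simps sum_subtractf axis_def
        if_distrib[of "\<lambda>t. _ * t"] cong: if_cong)
  have "dJ1 J (\<lambda>w. f w *\<^sub>R \<rho> w) z
      = (\<Sum>\<alpha>\<in>UNIV. \<rho> z $ \<alpha> *\<^sub>R wedge (dJ0 J f z) (axis \<alpha> 1)) + f z *\<^sub>R dJ1 J \<rho> z"
    by (simp add: dJ1_def a b sum.distrib sum_subtractf scaleR_sum_right scaleR_diff_right)
  then show ?thesis by (simp add: c)
qed

lemma dJ1_d_coordinate:
  fixes J :: "real^'k::finite \<Rightarrow> real^'k^'k"
  shows "dJ1 J (\<lambda>w. d0 (\<lambda>q. q $ \<alpha>) w) z = - d1 (dJ0 J (\<lambda>q. q $ \<alpha>)) z"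
proof -
  have p: "d0 (\<lambda>q. q $ \<alpha>) w = axis \<alpha> 1" for w :: "real^'k"
  proof -
    have "((\<lambda>q::real^'k. q $ \<alpha>) has_derivative (\<lambda>q. q $ \<alpha>)) (at w)"
      by (simp add: bounded_linear_imp_has_derivative bounded_linear_vec_nth)
    from frechet_derivative_at[OF this, symmetric] show ?thesis
      by (auto simp: d0_def partial_def vec_eq_iff axis_def)
  qed
  have "dJ0 J (\<lambda>w. axis \<alpha> 1 $ \<beta>) z = 0" for \<beta>
    by (simp add: dJ0_def d0_def partial_const adj_act_def vec_eq_iff matrix_vector_mult_def)
  moreover have "wedge 0 v = 0" for v :: "real^'k"
    by (simp add: wedge_def vec_eq_iff)
  moreover have "(\<Sum>\<beta>\<in>UNIV. - (axis \<alpha> 1 $ \<beta> *\<^sub>R F \<beta>)) = - F \<alpha>" for F :: "'k \<Rightarrow> real^'k^'k"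
    by (simp add: sum_negf axis_def if_distrib[of "\<lambda>t. t *\<^sub>R _"] cong: if_cong)
  ultimately show ?thesis
    by (simp add: dJ1_def p)
qed

end

theory Submission
  imports Defs
begin

text \<open>
  Put \<open>T = g J\<close> with all indices lowered. Since \<open>g\<close> is block diagonal, \<open>S = g\<^sub>2 J2bar\<close> is the
  Schur complement \<open>T\<^sub>2\<^sub>2 - T\<^sub>2\<^sub>1 T\<^sub>1\<^sub>1\<^sup>-\<^sup>1 T\<^sub>1\<^sub>2\<close>, and the only Christoffel symbols of \<open>g\<close> involving an
  \<open>x\<close>-direction are those of \<open>g\<^sub>2\<close>. In an \<open>x\<close>-direction the Killing equation says that \<open>T\<^sub>1\<^sub>1\<close> is
  constant and gives the covariant derivatives of the other blocks; combining them shows that \<open>S\<close>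
  satisfies an equation of the same form with a modified one-form, which contraction with
  \<open>g\<^sub>2\<close> identifies as \<open>d (tr J2bar)\<close>. For the cofactor, the lower right block of \<open>J\<^sup>-\<^sup>1\<close> is
  \<open>J2bar\<^sup>-\<^sup>1\<close>, and \<open>det J = det J\<^sub>1 det J2bar\<close>.
\<close>

subsection \<open>Block matrices and cofactors\<close>

lemma matrix_mult_diff_left:
  fixes A :: "real^'n::finite^'m::finite"
  shows "A ** (B - C) = A ** B - A ** C"
  by (simp add: matrix_matrix_mult_def vec_eq_iff algebra_simps sum_subtractf)

lemma matrix_mult_diff_right:
  fixes A :: "real^'n::finite^'m::finite"
  shows "(A - B) ** C = A ** C - B ** C"
  by (simp add: matrix_matrix_mult_def vec_eq_iff algebra_simps sum_subtractf)

lemma matrix_mult_add_right: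
  fixes A :: "real^'n::finite^'m::finite"
  shows "(A + B) ** C = A ** C + B ** C"
  by (simp add: matrix_matrix_mult_def vec_eq_iff algebra_simps sum.distrib)

lemma matrix_mult_uminus_left:
  fixes A :: "real^'n::finite^'m::finite"
  shows "(- A) ** C = - (A ** C)"
  by (simp add: matrix_matrix_mult_def vec_eq_iff sum_negf)

lemma matrix_mult_uminus_right:
  fixes A :: "real^'n::finite^'m::finite"
  shows "A ** (- C) = - (A ** C)"
  by (simp add: matrix_matrix_mult_def vec_eq_iff sum_negf)

lemmas matrix_ring = matrix_mult_diff_left matrix_mult_diff_right matrix_add_ldistrib
  matrix_mult_add_right matrix_mult_uminus_left matrix_mult_uminus_right

lemma matrix_inv_det:
  fixes A :: "real^'n::finite^'n"
  assumes "det A \<noteq> 0"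
  shows "A ** matrix_inv A = mat 1" "matrix_inv A ** A = mat 1"
proof -
  obtain B where "A ** B = mat 1 \<and> B ** A = mat 1"
    using assms invertible_det_nz[of A] by (auto simp: invertible_def)
  then have "A ** matrix_inv A = mat 1 \<and> matrix_inv A ** A = mat 1"
    unfolding matrix_inv_def by (rule someI)
  then show "A ** matrix_inv A = mat 1" "matrix_inv A ** A = mat 1" by auto
qed

text \<open>Taking determinants in the hypothesis shows that \<open>A\<close> is nonsingular, so a
  right inverse must be the matrix chosen by \<open>matrix_inv\<close>. Later inverses are
  identified through this lemma.\<close>

lemma matrix_inv_unique_right:
  fixes A :: "real^'n::finite^'n"
  assumes "A ** B = mat 1"
  shows "matrix_inv A = B"
proof -
  have "det A * det B = 1"
    using assms by (metis det_I det_mul)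
  then have "det A \<noteq> 0" by auto
  then have "matrix_inv A = matrix_inv A ** (A ** B)"
    by (simp add: assms)
  also have "\<dots> = B"
    using \<open>det A \<noteq> 0\<close> by (simp add: matrix_mul_assoc matrix_inv_det)
  finally show ?thesis .
qed

lemma transpose_matrix_inv:
  fixes A :: "real^'n::finite^'n"
  assumes "det A \<noteq> 0"
  shows "matrix_inv (transpose A) = transpose (matrix_inv A)"
  by (rule matrix_inv_unique_right)
    (simp add: matrix_transpose_mul[symmetric] matrix_inv_det assms)

lemma matrix_inv_cof:
  fixes A :: "real^'n::finite^'n"
  assumes "det A \<noteq> 0"
  shows "matrix_inv A = inverse (det A) *\<^sub>R cof A"
  using assms cof_mult_right[OF assms]
  by (intro matrix_inv_unique_right) (simp add: matrix_scalar_ac scalar_matrix_assoc[symmetric])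

text \<open>Multiply the hypothesis by \<open>cof A\<close> on the right. The scalar
  \<open>c\<close> is kept separate from \<open>det A\<close> because in the application it is the
  determinant of a larger matrix.\<close>

lemma cof_unique:
  fixes A :: "real^'n::finite^'n"
  assumes "det A \<noteq> 0" "X ** A = c *\<^sub>R mat 1"
  shows "det A *\<^sub>R X = c *\<^sub>R cof A"
proof -
  have "X ** (A ** cof A) = c *\<^sub>R cof A"
    by (simp add: matrix_mul_assoc assms(2) scalar_matrix_assoc[symmetric])
  then show ?thesis
    by (simp add: cof_mult_right[OF assms(1)] matrix_scalar_ac)
qed

text \<open>A nonzero kernel vector would make the quadratic form vanish.\<close>

lemma det_pos_def_nz:
  fixes A :: "real^'n::finite^'n"
  assumes "\<And>v. v \<noteq> 0 \<Longrightarrow> v \<bullet> (A *v v) > 0"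
  shows "det A \<noteq> 0"
proof -
  have "\<forall>v. A *v v = 0 \<longrightarrow> v = 0"
    using assms by (metis inner_zero_right less_irrefl)
  then show ?thesis
    using invertible_det_nz[of A] matrix_left_invertible_ker[of A] invertible_left_inverse[of A]
    by auto
qed

section \<open>Matrices divided into four blocks\<close>

definition block_matrix ::
  "real^'m^'m \<Rightarrow> real^'n^'m \<Rightarrow> real^'m^'n \<Rightarrow> real^'n^'n \<Rightarrow> real^('m::finite + 'n::finite)^('m + 'n)" where
  "block_matrix A B C D = (\<chi> \<alpha> \<beta>.
     case \<alpha> of Inl i \<Rightarrow> (case \<beta> of Inl j \<Rightarrow> A $ i $ j | Inr b \<Rightarrow> B $ i $ b)
             | Inr a \<Rightarrow> (case \<beta> of Inl j \<Rightarrow> C $ a $ j | Inr b \<Rightarrow> D $ a $ b))"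

definition block12 :: "real^('m::finite + 'n::finite)^('m + 'n) \<Rightarrow> real^'n^'m" where
  "block12 T = (\<chi> i b. T $ Inl i $ Inr b)"

definition block21 :: "real^('m::finite + 'n::finite)^('m + 'n) \<Rightarrow> real^'m^'n" where
  "block21 T = (\<chi> a j. T $ Inr a $ Inl j)"

lemma block_matrix_nth [simp]:
  "block_matrix A B C D $ Inl i $ Inl j = A $ i $ j"
  "block_matrix A B C D $ Inl i $ Inr b = B $ i $ b"
  "block_matrix A B C D $ Inr a $ Inl j = C $ a $ j"
  "block_matrix A B C D $ Inr a $ Inr b = D $ a $ b"
  by (simp_all add: block_matrix_def)

lemma block_extract [simp]:
  "restrict_Kperp (block_matrix A B C D) = A" "block12 (block_matrix A B C D) = B"
  "block21 (block_matrix A B C D) = C" "restrict_K (block_matrix A B C D) = D"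
  by (simp_all add: restrict_Kperp_def restrict_K_def block12_def block21_def vec_eq_iff)

lemma forall_sum_index: "(\<forall>\<alpha>. P \<alpha>) \<longleftrightarrow> (\<forall>i. P (Inl i)) \<and> (\<forall>a. P (Inr a))"
  by (metis sum.exhaust)

lemma sum_sum_index:
  "(\<Sum>\<alpha>\<in>UNIV. f \<alpha>) = (\<Sum>i\<in>UNIV. f (Inl i)) + (\<Sum>a\<in>UNIV. f (Inr a))"
  for f :: "'m::finite + 'n::finite \<Rightarrow> real"
  using sum.Plus[of "UNIV :: 'm set" "UNIV :: 'n set" f] by (simp add: o_def)

text \<open>Every square matrix over the sum index type has block form, so a proof may simply name
  its four blocks.\<close>

lemma block_matrix_collapse:
  "block_matrix (restrict_Kperp T) (block12 T) (block21 T) (restrict_K T) = T"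
  by (simp add: vec_eq_iff forall_sum_index restrict_Kperp_def restrict_K_def block12_def block21_def)

lemma block_matrix_eq_iff:
  "block_matrix A B C D = block_matrix A' B' C' D' \<longleftrightarrow> A = A' \<and> B = B' \<and> C = C' \<and> D = D'"
  by (metis block_extract)

lemma block_matrix_mult:
  "block_matrix A B C D ** block_matrix A' B' C' D' =
   block_matrix (A ** A' + B ** C') (A ** B' + B ** D') (C ** A' + D ** C') (C ** B' + D ** D')"
  by (simp add: vec_eq_iff forall_sum_index matrix_matrix_mult_def sum_sum_index)

lemma block_matrix_one: "mat 1 = block_matrix (mat 1) 0 0 (mat 1)"
  by (simp add: vec_eq_iff forall_sum_index mat_def)

lemma block_matrix_scaleR:
  "c *\<^sub>R block_matrix A B C D = block_matrix (c *\<^sub>R A) (c *\<^sub>R B) (c *\<^sub>R C) (c *\<^sub>R D)"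
  by (simp add: vec_eq_iff forall_sum_index)

lemma transpose_zero [simp]: "transpose (0 :: real^'n::finite^'m::finite) = 0"
  by (simp add: vec_eq_iff transpose_def)

lemma transpose_block_matrix:
  "transpose (block_matrix A B C D) =
   block_matrix (transpose A) (transpose C) (transpose B) (transpose D)"
  by (simp add: vec_eq_iff forall_sum_index transpose_def)

lemma P1_block: "P1 = block_matrix (mat 1) 0 0 0"
  by (auto simp: vec_eq_iff forall_sum_index P1_def mat_def)

lemma P2_block: "P2 = block_matrix 0 0 0 (mat 1)"
  by (auto simp: vec_eq_iff forall_sum_index P2_def mat_def)

lemma J1_block [simp]: "J1 (block_matrix A B C D) = A"
  by (simp add: J1_def P1_block block_matrix_mult)

lemma restrict_K_P2_block [simp]: "restrict_K (P2 ** block_matrix A B C D ** P2) = D"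
  by (simp add: P2_block block_matrix_mult)

text \<open>The double sum in \<open>J2bar\<close> is a triple matrix product up to the order of
  summation. Thus \<open>J2bar\<close> is the Schur complement of the upper left block.\<close>

lemma J2bar_block: "J2bar (block_matrix A B C D) = D - C ** matrix_inv A ** B"
proof -
  have "(\<Sum>i\<in>UNIV. \<Sum>j\<in>UNIV. C $ a $ i * matrix_inv A $ i $ j * B $ j $ b) =
      (C ** matrix_inv A ** B) $ a $ b" for a b
    unfolding matrix_matrix_mult_def
    by (simp add: sum_distrib_right) (rule sum.swap)
  then show ?thesis
    by (simp add: J2bar_def vec_eq_iff)
qed

text \<open>The matrix acting as \<open>A\<close> on the coordinates in the range of \<open>f\<close> and as the identity on the
  remaining ones; taking \<open>f\<close> to be \<open>Inl\<close> and \<open>Inr\<close> treats both diagonal blocks at once.\<close>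

definition matrix_extend :: "('k::finite \<Rightarrow> 'p) \<Rightarrow> real^'k^'k \<Rightarrow> real^'p::finite^'p" where
  "matrix_extend f A = (\<chi> \<alpha> \<beta>. if \<alpha> \<in> range f \<and> \<beta> \<in> range f
     then A $ the_inv f \<alpha> $ the_inv f \<beta> else of_bool (\<alpha> = \<beta>))"

lemma matrix_extend_nth:
  fixes f :: "'k::finite \<Rightarrow> 'p::finite"
  assumes "inj f"
  shows "matrix_extend f A $ f i $ f j = A $ i $ j"
    "\<alpha> \<notin> range f \<Longrightarrow> matrix_extend f A $ \<alpha> $ \<beta> = of_bool (\<alpha> = \<beta>)"
    "\<beta> \<notin> range f \<Longrightarrow> matrix_extend f A $ \<alpha> $ \<beta> = of_bool (\<alpha> = \<beta>)"
  using assms by (auto simp: matrix_extend_def the_inv_f_f)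

lemma matrix_extend_eqI:
  fixes f :: "'k::finite \<Rightarrow> 'p::finite"
  assumes "inj f" "\<And>i j. M $ f i $ f j = A $ i $ j"
    "\<And>\<alpha> \<beta>. \<alpha> \<notin> range f \<or> \<beta> \<notin> range f \<Longrightarrow> M $ \<alpha> $ \<beta> = of_bool (\<alpha> = \<beta>)"
  shows "matrix_extend f A = M"
proof -
  have "matrix_extend f A $ \<alpha> $ \<beta> = M $ \<alpha> $ \<beta>" for \<alpha> \<beta>
  proof (cases "\<alpha> \<in> range f \<and> \<beta> \<in> range f")
    case True
    then show ?thesis using assms(1,2) by (auto simp: matrix_extend_nth)
  next
    case False
    then show ?thesis using assms(1,3) by (auto simp: matrix_extend_nth)
  qed
  then show ?thesis by (simp add: vec_eq_iff)
qed

text \<open>The sum over the intermediate index splits into the range of \<open>f\<close> and its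
  complement. Entries linking the two parts vanish, so the two parts do not interact.\<close>

lemma matrix_extend_mult:
  fixes f :: "'k::finite \<Rightarrow> 'p::finite"
  assumes "inj f"
  shows "matrix_extend f (A ** B) = matrix_extend f A ** matrix_extend f B"
proof (rule matrix_extend_eqI[OF assms])
  have split: "(matrix_extend f A ** matrix_extend f B) $ \<alpha> $ \<beta> =
      (\<Sum>k\<in>UNIV. matrix_extend f A $ \<alpha> $ f k * matrix_extend f B $ f k $ \<beta>) +
      (\<Sum>\<gamma>\<in>- range f. matrix_extend f A $ \<alpha> $ \<gamma> * matrix_extend f B $ \<gamma> $ \<beta>)" for \<alpha> \<beta>
  proof -
    have "(matrix_extend f A ** matrix_extend f B) $ \<alpha> $ \<beta> =
        (\<Sum>\<gamma>\<in>range f \<union> - range f. matrix_extend f A $ \<alpha> $ \<gamma> * matrix_extend f B $ \<gamma> $ \<beta>)"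
      by (simp add: matrix_matrix_mult_def)
    also have "\<dots> = (\<Sum>\<gamma>\<in>range f. matrix_extend f A $ \<alpha> $ \<gamma> * matrix_extend f B $ \<gamma> $ \<beta>) +
        (\<Sum>\<gamma>\<in>- range f. matrix_extend f A $ \<alpha> $ \<gamma> * matrix_extend f B $ \<gamma> $ \<beta>)"
      by (rule sum.union_disjoint) auto
    finally show ?thesis
      by (simp add: sum.reindex[OF assms] o_def)
  qed
  show "(matrix_extend f A ** matrix_extend f B) $ f i $ f j = (A ** B) $ i $ j" for i j
  proof -
    have "(\<Sum>\<gamma>\<in>- range f. matrix_extend f A $ f i $ \<gamma> * matrix_extend f B $ \<gamma> $ f j) = 0"
      using assms by (intro sum.neutral) (auto simp: matrix_extend_nth)
    then show ?thesis
      by (simp add: split matrix_extend_nth[OF assms]) (simp add: matrix_matrix_mult_def)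
  qed
  show "(matrix_extend f A ** matrix_extend f B) $ \<alpha> $ \<beta> = of_bool (\<alpha> = \<beta>)"
    if "\<alpha> \<notin> range f \<or> \<beta> \<notin> range f" for \<alpha> \<beta>
  proof -
    have "(\<Sum>k\<in>UNIV. matrix_extend f A $ \<alpha> $ f k * matrix_extend f B $ f k $ \<beta>) = 0"
      using that assms by (intro sum.neutral) (auto simp: matrix_extend_nth)
    \<comment> \<open>If \<alpha> lies in the range of \<open>f\<close>, no \<gamma> equals it and
      the sum is 0. In that case \<beta> lies outside the range, so 0 is still the correct entry of
      the identity.\<close>
    moreover have "(\<Sum>\<gamma>\<in>- range f. matrix_extend f A $ \<alpha> $ \<gamma> * matrix_extend f B $ \<gamma> $ \<beta>)
        = (\<Sum>\<gamma>\<in>- range f. if \<gamma> = \<alpha> then of_bool (\<alpha> = \<beta>) else 0)"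
      using assms by (intro sum.cong) (auto simp: matrix_extend_nth)
    ultimately show ?thesis
      using that by (auto simp: split)
  qed
qed

text \<open>Both sides are multiplicative, so it suffices to check matrices that generate all
  others: those with a zero row, diagonal ones, transpositions of two columns and elementary shears.
  No comparison of the permutations of the two index types is required.\<close>

lemma det_matrix_extend:
  fixes f :: "'k::finite \<Rightarrow> 'p::finite"
  assumes f: "inj f"
  shows "det (matrix_extend f A) = det A"
proof (rule induct_matrix_elementary_alt[where P = "\<lambda>A. det (matrix_extend f A) = det A"])
  fix A B :: "real^'k^'k"
  assume "det (matrix_extend f A) = det A" "det (matrix_extend f B) = det B"
  then show "det (matrix_extend f (A ** B)) = det (A ** B)" by (simp add: matrix_extend_mult[OF f] det_mul)
next
  fix A :: "real^'k^'k" and i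
  assume zero_row: "row i A = 0"
  have "row (f i) (matrix_extend f A) = 0"
  proof -
    have "matrix_extend f A $ f i $ \<beta> = 0" for \<beta>
    proof (cases "\<beta> \<in> range f")
      case True
      then show ?thesis
        using zero_row by (auto simp: matrix_extend_nth[OF f] row_def vec_eq_iff)
    qed (auto simp: matrix_extend_nth[OF f])
    then show ?thesis by (simp add: row_def vec_eq_iff)
  qed
  then show "det (matrix_extend f A) = det A" using zero_row by (simp add: det_zero_row)
next
  fix A :: "real^'k^'k"
  assume diagonal: "\<And>i j. i \<noteq> j \<Longrightarrow> A $ i $ j = 0"
  have off: "matrix_extend f A $ \<alpha> $ \<beta> = 0" if "\<alpha> \<noteq> \<beta>" for \<alpha> \<beta>
    using that by (auto simp: matrix_extend_def f the_inv_f_f intro!: diagonal)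
  have "det (matrix_extend f A) = (\<Prod>\<alpha>\<in>UNIV. matrix_extend f A $ \<alpha> $ \<alpha>)"
    by (rule det_diagonal) (rule off)
  also have "\<dots> = (\<Prod>\<alpha>\<in>range f. matrix_extend f A $ \<alpha> $ \<alpha>)"
    by (rule prod.mono_neutral_right) (auto simp: matrix_extend_nth[OF f])
  also have "\<dots> = (\<Prod>i\<in>UNIV. A $ i $ i)"
    by (simp add: prod.reindex[OF f] matrix_extend_nth[OF f])
  also have "\<dots> = det A"
    by (rule det_diagonal[symmetric]) (rule diagonal)
  finally show "det (matrix_extend f A) = det A" .
next
  fix m n :: 'k
  assume "m \<noteq> n"
  have 1: "matrix_extend f (\<chi> i j. mat 1 $ i $ Transposition.transpose m n j) =
      (\<chi> \<alpha> \<beta>. mat 1 $ \<alpha> $ Transposition.transpose (f m) (f n) \<beta>)"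
    by (rule matrix_extend_eqI[OF f])
      (auto simp: mat_def inj_eq[OF f] Transposition.transpose_def)
  have swap: "det (\<chi> \<alpha> \<beta>. mat 1 $ \<alpha> $ Transposition.transpose a b \<beta> :: real^'q^'q) = -1"
    if "a \<noteq> b" for a b :: "'q::finite"
    using that det_permute_columns[of "Transposition.transpose a b" "mat 1 :: real^'q^'q"]
    by (simp add: permutes_swap_id sign_swap_id)
  show "det (matrix_extend f (\<chi> i j. mat 1 $ i $ Transposition.transpose m n j)) =
      det (\<chi> i j. mat 1 $ i $ Transposition.transpose m n j :: real^'k^'k)"
    unfolding 1 using \<open>m \<noteq> n\<close> f by (simp add: inj_eq swap)
next
  fix m n :: 'k
  assume "m \<noteq> n"
  have 1: "matrix_extend f (\<chi> i j. of_bool (i = m \<and> j = n \<or> i = j)) =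
      (\<chi> \<alpha> \<beta>. of_bool (\<alpha> = f m \<and> \<beta> = f n \<or> \<alpha> = \<beta>))"
    by (rule matrix_extend_eqI[OF f]) (auto simp: inj_eq[OF f])
  have shear: "det (\<chi> \<alpha> \<beta>. of_bool (\<alpha> = a \<and> \<beta> = b \<or> \<alpha> = \<beta>) :: real^'q^'q) = 1"
    if "a \<noteq> b" for a b :: "'q::finite"
  proof -
    have "(\<chi> \<alpha> \<beta>. of_bool (\<alpha> = a \<and> \<beta> = b \<or> \<alpha> = \<beta>) :: real^'q^'q) =
        (\<chi> k. if k = a then row a (mat 1) + 1 *s row b (mat 1) else row k (mat 1))"
      using that by (auto simp: vec_eq_iff row_def mat_def)
    then show ?thesis
      using det_row_operation[OF that, of "mat 1 :: real^'q^'q" 1] by simp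
  qed
  show "det (matrix_extend f (\<chi> i j. of_bool (i = m \<and> j = n \<or> i = j))) =
      det (\<chi> i j. of_bool (i = m \<and> j = n \<or> i = j) :: real^'k^'k)"
    unfolding 1 using \<open>m \<noteq> n\<close> f by (simp only: inj_eq shear not_False_eq_True)
qed

section \<open>Determinants of block matrices and the cofactor formula\<close>

text \<open>The matrix is a product of two factors, each extending one diagonal block by the
  identity.\<close>

lemma det_block_diag:
  fixes A :: "real^'m::finite^'m" and D :: "real^'n::finite^'n"
  shows "det (block_matrix A 0 0 D) = det A * det D"
proof -
  have "matrix_extend Inl A = block_matrix A 0 0 (mat 1 :: real^'n^'n)"
    by (rule matrix_extend_eqI)
      (auto simp: image_iff mat_def block_matrix_def split: sum.splits)
  moreover have "matrix_extend Inr D = block_matrix (mat 1 :: real^'m^'m) 0 0 D"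
    by (rule matrix_extend_eqI)
      (auto simp: image_iff mat_def block_matrix_def split: sum.splits)
  ultimately have "det (block_matrix A 0 0 (mat 1 :: real^'n^'n)) = det A"
    "det (block_matrix (mat 1 :: real^'m^'m) 0 0 D) = det D"
    by (metis det_matrix_extend inj_Inl, metis det_matrix_extend inj_Inr)
  moreover have "block_matrix A 0 0 D = block_matrix A 0 0 (mat 1) ** block_matrix (mat 1) 0 0 D"
    by (simp add: block_matrix_mult)
  ultimately show ?thesis by (simp add: det_mul)
qed

text \<open>\<open>B\<close> and \<open>2 B\<close> give conjugate unipotent matrices, and the second is the square of the first.
  Hence the determinant \<open>d\<close> satisfies \<open>d\<^sup>2 = d\<close>, and \<open>d \<noteq> 0\<close>.\<close>

lemma det_block_unipotent:
  fixes B :: "real^'n::finite^'m::finite"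
  shows "det (block_matrix (mat 1) B 0 (mat 1)) = 1"
proof -
  let ?N = "\<lambda>B :: real^'n^'m. block_matrix (mat 1) B 0 (mat 1)"
  define E where "E c = block_matrix (c *\<^sub>R mat 1 :: real^'m^'m) 0 0 (mat 1 :: real^'n^'n)" for c
  have "?N B ** ?N B = ?N (B + B)" "?N B ** ?N (- B) = mat 1"
    by (simp_all add: block_matrix_mult block_matrix_one)
  then have sq: "det (?N (B + B)) = det (?N B) * det (?N B)" and "det (?N B) * det (?N (- B)) = 1"
    by (metis det_mul, metis det_mul det_I)
  then have nz: "det (?N B) \<noteq> 0" by auto
  have "E c ** ?N B = ?N (c *\<^sub>R B) ** E c" for c
    by (simp add: E_def block_matrix_mult scalar_matrix_assoc[symmetric])
  from this[of 2] have "det (E 2) * det (?N B) = det (?N (B + B)) * det (E 2)"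
    by (metis det_mul scaleR_2)
  moreover have "det (E c) \<noteq> 0" if "c \<noteq> 0" for c
  proof -
    have "det (c *\<^sub>R mat 1 :: real^'m^'m) = c ^ CARD('m)"
      by (subst det_diagonal) (simp_all add: mat_def)
    then show ?thesis
      using that by (simp add: E_def det_block_diag)
  qed
  then have "det (E 2) \<noteq> 0" by simp
  ultimately have "det (?N (B + B)) = det (?N B)" by simp
  with sq nz show ?thesis by simp
qed

text \<open>Block elimination: the matrix factors into lower unipotent, block diagonal and upper
  unipotent parts. The lower factor is reduced to \<open>det_block_unipotent\<close> by
  transposition.\<close>

lemma det_block_schur:
  assumes "det A \<noteq> 0"
  shows "det (block_matrix A B C D) = det A * det (D - C ** matrix_inv A ** B)"
proof -
  let ?L = "block_matrix (mat 1) 0 (C ** matrix_inv A) (mat 1)"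
  have "transpose ?L = block_matrix (mat 1) (transpose (C ** matrix_inv A)) 0 (mat 1)"
    by (simp add: transpose_block_matrix)
  then have "det ?L = 1"
    by (metis det_block_unipotent det_transpose)
  moreover have "block_matrix A B C D = ?L ** (block_matrix A 0 0 (D - C ** matrix_inv A ** B) **
      block_matrix (mat 1) (matrix_inv A ** B) 0 (mat 1))"
    using matrix_inv_det[OF assms]
    by (simp add: block_matrix_mult matrix_mul_assoc[symmetric])
      (simp add: matrix_mul_assoc matrix_inv_det[OF assms])
  ultimately show ?thesis
    by (simp add: det_mul det_block_diag det_block_unipotent)
qed

text \<open>Only the lower two blocks of the identity
  \<open>cof T ** T = det T *\<^sub>R mat 1\<close> enter. Eliminating \<open>Z\<close> between them
  shows that \<open>W ** ?S\<close> is \<open>det T\<close> times the identity, which determines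
  \<open>W\<close> as a multiple of \<open>cof ?S\<close>.\<close>

lemma cof_J2bar:
  assumes "det T \<noteq> 0" "det (J1 T) \<noteq> 0"
  shows "cof (J2bar T) = inverse (det (J1 T)) *\<^sub>R restrict_K (P2 ** cof T ** P2)"
proof -
  obtain A B C D where T: "T = block_matrix A B C D"
    by (metis block_matrix_collapse)
  obtain X Y Z W where X: "cof T = block_matrix X Y Z W"
    by (metis block_matrix_collapse)
  have A: "det A \<noteq> 0" using assms(2) by (simp add: T)
  let ?S = "D - C ** matrix_inv A ** B"
  have dT: "det T = det A * det ?S"
    by (simp add: T det_block_schur[OF A])
  with assms(1) have S: "det ?S \<noteq> 0" by auto
  have "block_matrix X Y Z W ** block_matrix A B C D = det T *\<^sub>R mat 1"
    using cof_mult_left[of T] by (metis X T)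
  then have ZA: "Z ** A + W ** C = 0" and ZB: "Z ** B + W ** D = det T *\<^sub>R mat 1"
    by (simp_all add: block_matrix_mult block_matrix_one block_matrix_scaleR block_matrix_eq_iff)
  have "Z = Z ** A ** matrix_inv A"
    by (simp add: matrix_mul_assoc[symmetric] matrix_inv_det[OF A])
  also have "Z ** A = - (W ** C)"
    using ZA by (simp add: eq_neg_iff_add_eq_0)
  finally have "W ** ?S = det T *\<^sub>R mat 1"
    using ZB by (simp add: matrix_ring matrix_mul_assoc)
  then have "det ?S *\<^sub>R W = det T *\<^sub>R cof ?S"
    by (rule cof_unique[OF S])
  \<comment> \<open>By the Schur formula \<open>det T\<close> contains the nonzero factor
    \<open>det ?S\<close>, which cancels.\<close>
  then have "W = det A *\<^sub>R cof ?S"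
    using S scaleR_cancel_left[of "det ?S" W "det A *\<^sub>R cof ?S"] by (simp add: dT mult.commute)
  then show ?thesis
    using A by (simp add: X) (simp add: T J2bar_block)
qed


subsection \<open>Smooth functions and partial derivatives\<close>

lemma has_derivative_cong_open:
  assumes "open U" "z \<in> U" "\<And>w. w \<in> U \<Longrightarrow> f w = h w"
  shows "(f has_derivative f') (at z) \<longleftrightarrow> (h has_derivative f') (at z)"
  using has_derivative_transform_within_open[of f f' z UNIV U h]
    has_derivative_transform_within_open[of h f' z UNIV U f] assms by auto

lemma differentiable_cong_open:
  assumes "open U" "z \<in> U" "\<And>w. w \<in> U \<Longrightarrow> f w = h w"
  shows "f differentiable (at z) \<longleftrightarrow> h differentiable (at z)"
  unfolding differentiable_def using has_derivative_cong_open[OF assms] by auto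

text \<open>\<open>frechet_derivative\<close> chooses from the set of derivatives at
  \<open>z\<close>, and this set is the same for both functions. Hence differentiability need not be
  checked.\<close>

lemma partial_cong_open:
  assumes "open U" "z \<in> U" "\<And>w. w \<in> U \<Longrightarrow> f w = h w"
  shows "partial k f z = partial k h z"
  unfolding partial_def frechet_derivative_def using has_derivative_cong_open[OF assms] by simp

lemma partial_eqI:
  assumes "(f has_derivative f') (at z)"
  shows "partial k f z = f' (axis k 1)"
  using frechet_derivative_at[OF assms] by (simp add: partial_def)

text \<open>Meant for slice embeddings such as \<open>join y\<close>, whose derivative sends basis
  vectors to basis vectors. The chain rule then yields a single partial derivative instead of a
  sum.\<close>

lemma partial_chain_affine:
  assumes "(L has_derivative L') (at x)" "L' (axis k 1) = axis l 1" "f differentiable (at (L x))"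
  shows "partial k (\<lambda>x. f (L x)) x = partial l f (L x)"
proof -
  have "(f has_derivative frechet_derivative f (at (L x))) (at (L x))"
    using assms(3) by (simp add: frechet_derivative_works)
  from partial_eqI[OF has_derivative_compose[OF assms(1) this]]
  show ?thesis by (simp add: assms(2) partial_def)
qed

lemma partial_sum:
  assumes "finite S" "\<And>i. i \<in> S \<Longrightarrow> f i differentiable (at z)"
  shows "partial k (\<lambda>w. \<Sum>i\<in>S. f i w) z = (\<Sum>i\<in>S. partial k (f i) z)"
  using assms
proof (induction S rule: finite_induct)
  case empty
  then show ?case by (simp add: partial_const)
next
  case (insert i S)
  have "(\<lambda>w. \<Sum>i\<in>S. f i w) differentiable (at z)"
    using insert by (intro differentiable_sum) auto
  then show ?case using insert by (simp add: partial_add)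
qed

text \<open>The right-hand side is written as a nested product with the constant \<open>- 1\<close>,
  so that \<open>Ck_on_mult\<close> and \<open>Ck_on_const\<close> apply to it directly.\<close>

lemma partial_inverse:
  assumes "f differentiable (at z)" "f z \<noteq> 0"
  shows "partial k (\<lambda>w. inverse (f w)) z = - 1 * (partial k f z * (inverse (f z) * inverse (f z)))"
proof -
  have "(f has_derivative frechet_derivative f (at z)) (at z)"
    using assms(1) by (simp add: frechet_derivative_works)
  from partial_eqI[OF Deriv.has_derivative_inverse[OF assms(2) this]]
  show ?thesis by (simp add: partial_def)
qed

section \<open>Closure properties of smooth functions\<close>

lemma Ck_on_cong:
  assumes "open U" "\<And>z. z \<in> U \<Longrightarrow> f z = h z"
  shows "Ck_on r f U \<longleftrightarrow> Ck_on r h U"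
  using assms(2)
proof (induction r arbitrary: f h)
  case 0
  then show ?case by (auto cong: continuous_on_cong)
next
  case (Suc r)
  have "f differentiable (at z) \<longleftrightarrow> h differentiable (at z)" if "z \<in> U" for z
    using differentiable_cong_open[OF assms(1) that] Suc.prems by auto
  moreover have "Ck_on r (partial k f) U \<longleftrightarrow> Ck_on r (partial k h) U" for k
    using partial_cong_open[OF assms(1)] Suc.prems by (intro Suc.IH) metis
  ultimately show ?case by auto
qed

text \<open>\<open>Ck_on (Suc r)\<close> does not mention continuity of the function itself; in the
  base case differentiability supplies it.\<close>

lemma Ck_on_Suc_imp: "Ck_on (Suc r) f U \<Longrightarrow> Ck_on r f U"
proof (induction r arbitrary: f)
  case 0
  then show ?case
    by (auto intro!: continuous_at_imp_continuous_on differentiable_imp_continuous_within)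
qed auto

lemma smooth_on_cong:
  assumes "open U" "\<And>z. z \<in> U \<Longrightarrow> f z = h z"
  shows "smooth_on U f \<longleftrightarrow> smooth_on U h"
  using Ck_on_cong[OF assms] by (simp add: smooth_on_def)

lemma smooth_on_imp_differentiable:
  assumes "smooth_on U f" "z \<in> U"
  shows "f differentiable (at z)"
  using assms(1)[unfolded smooth_on_def, rule_format, of 1] assms(2) by simp

lemma Ck_on_const: "Ck_on r (\<lambda>w. c) U"
proof (induction r arbitrary: c)
  case (Suc r)
  have "partial k (\<lambda>w. c) = (\<lambda>w. 0)" for k :: 'a
    by (simp add: fun_eq_iff partial_const)
  then show ?case using Suc by simp
qed simp

lemma Ck_on_add:
  assumes "open U"
  shows "Ck_on r f U \<Longrightarrow> Ck_on r h U \<Longrightarrow> Ck_on r (\<lambda>w. f w + h w) U"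
proof (induction r arbitrary: f h)
  case 0
  then show ?case by (auto intro: continuous_on_add)
next
  case (Suc r)
  have "Ck_on r (partial k (\<lambda>w. f w + h w)) U" for k
  proof -
    have "Ck_on r (\<lambda>z. partial k f z + partial k h z) U"
      using Suc by auto
    then show ?thesis
      by (subst Ck_on_cong[OF assms]) (use Suc.prems in \<open>auto simp: partial_add\<close>)
  qed
  then show ?case using Suc.prems by auto
qed

lemma Ck_on_mult:
  assumes "open U"
  shows "Ck_on r f U \<Longrightarrow> Ck_on r h U \<Longrightarrow> Ck_on r (\<lambda>w. f w * h w) U"
proof (induction r arbitrary: f h)
  case 0
  then show ?case by (auto intro: continuous_on_mult)
next
  case (Suc r)
  have "Ck_on r (partial k (\<lambda>w. f w * h w)) U" for k
  proof -
    \<comment> \<open>The product rule retains undifferentiated factors, which must also be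
      available at level \<open>r\<close>.\<close>
    have "Ck_on r f U" "Ck_on r h U"
      using Suc.prems by (auto intro: Ck_on_Suc_imp)
    then have "Ck_on r (\<lambda>z. f z * partial k h z + h z * partial k f z) U"
      using Suc by (intro Ck_on_add[OF assms] Suc.IH) auto
    then show ?thesis
      by (subst Ck_on_cong[OF assms]) (use Suc.prems in \<open>auto simp: partial_mult\<close>)
  qed
  then show ?case using Suc.prems by auto
qed

text \<open>The induction keeps \<open>f\<close> fixed: the derivative of its reciprocal is a
  polynomial in that reciprocal and \<open>partial k f\<close>, and the induction hypothesis covers
  the reciprocal at the lower level.\<close>

lemma Ck_on_inverse:
  assumes "open U" "\<And>z. z \<in> U \<Longrightarrow> f z \<noteq> 0"
  shows "Ck_on r f U \<Longrightarrow> Ck_on r (\<lambda>w. inverse (f w)) U"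
proof (induction r)
  case 0
  then show ?case using assms by (auto intro: continuous_on_inverse)
next
  case (Suc r)
  have "Ck_on r (partial k (\<lambda>w. inverse (f w))) U" for k
  proof -
    have "Ck_on r (\<lambda>w. inverse (f w)) U"
      using Suc Ck_on_Suc_imp by auto
    then have "Ck_on r (\<lambda>z. - 1 * (partial k f z * (inverse (f z) * inverse (f z)))) U"
      using Suc by (intro Ck_on_mult[OF assms(1)] Ck_on_const) auto
    then show ?thesis
      by (subst Ck_on_cong[OF assms(1)]) (use Suc.prems assms in \<open>auto simp: partial_inverse\<close>)
  qed
  then show ?case using Suc.prems assms by auto
qed

lemma Ck_on_affine:
  assumes "open V" "\<And>x. x \<in> V \<Longrightarrow> L x \<in> U"
    "\<And>x. (L has_derivative L') (at x)" "\<And>k. L' (axis k 1) = axis (l k) 1"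
  shows "Ck_on r f U \<Longrightarrow> Ck_on r (\<lambda>x. f (L x)) V"
proof (induction r arbitrary: f)
  case 0
  have "continuous_on V L"
    using assms(3) by (intro continuous_at_imp_continuous_on) (blast intro: has_derivative_continuous)
  then show ?case
    using 0 assms(2) by (auto intro!: continuous_on_compose2[of U f V L])
next
  case (Suc r)
  have "(\<lambda>x. f (L x)) differentiable (at x)" if "x \<in> V" for x
  proof -
    have "f differentiable (at (L x))"
      using Suc.prems assms(2) that by auto
    then obtain f' where "(f has_derivative f') (at (L x))"
      by (auto simp: differentiable_def)
    from has_derivative_compose[OF assms(3) this] show ?thesis
      by (auto simp: differentiable_def)
  qed
  moreover have "Ck_on r (partial k (\<lambda>x. f (L x))) V" for k
  proof -
    have "Ck_on r (\<lambda>x. partial (l k) f (L x)) V"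
      using Suc by auto
    moreover have "partial k (\<lambda>x. f (L x)) x = partial (l k) f (L x)" if "x \<in> V" for x
      using Suc.prems assms that by (intro partial_chain_affine[where L' = L']) auto
    ultimately show ?thesis
      using Ck_on_cong[OF assms(1), of "partial k (\<lambda>x. f (L x))" "\<lambda>x. partial (l k) f (L x)" r]
      by simp
  qed
  ultimately show ?case by auto
qed

lemma smooth_on_const: "smooth_on U (\<lambda>w. c)"
  by (simp add: smooth_on_def Ck_on_const)

lemma smooth_on_add:
  "open U \<Longrightarrow> smooth_on U f \<Longrightarrow> smooth_on U h \<Longrightarrow> smooth_on U (\<lambda>w. f w + h w)"
  by (simp add: smooth_on_def Ck_on_add)

lemma smooth_on_mult:
  "open U \<Longrightarrow> smooth_on U f \<Longrightarrow> smooth_on U h \<Longrightarrow> smooth_on U (\<lambda>w. f w * h w)"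
  by (simp add: smooth_on_def Ck_on_mult)

lemma smooth_on_diff:
  assumes "open U" "smooth_on U f" "smooth_on U h"
  shows "smooth_on U (\<lambda>w. f w - h w)"
  using smooth_on_add[OF assms(1,2) smooth_on_mult[OF assms(1) smooth_on_const[of U "- 1"] assms(3)]]
  by simp

lemma smooth_on_inverse:
  "open U \<Longrightarrow> (\<And>z. z \<in> U \<Longrightarrow> f z \<noteq> 0) \<Longrightarrow> smooth_on U f \<Longrightarrow> smooth_on U (\<lambda>w. inverse (f w))"
  by (simp add: smooth_on_def Ck_on_inverse)

lemma smooth_on_sum:
  "open U \<Longrightarrow> (\<And>i. i \<in> S \<Longrightarrow> smooth_on U (f i)) \<Longrightarrow> smooth_on U (\<lambda>w. \<Sum>i\<in>S. f i w)"
  by (induction S rule: infinite_finite_induct) (auto simp: smooth_on_const smooth_on_add)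

lemma smooth_on_prod:
  "open U \<Longrightarrow> (\<And>i. i \<in> S \<Longrightarrow> smooth_on U (f i)) \<Longrightarrow> smooth_on U (\<lambda>w. \<Prod>i\<in>S. f i w)"
  by (induction S rule: infinite_finite_induct) (auto simp: smooth_on_const smooth_on_mult)

lemma smooth_on_affine:
  assumes "open V" "\<And>x. x \<in> V \<Longrightarrow> L x \<in> U"
    "\<And>x. (L has_derivative L') (at x)" "\<And>k. L' (axis k 1) = axis (l k) 1" "smooth_on U f"
  shows "smooth_on V (\<lambda>x. f (L x))"
  using assms(5) unfolding smooth_on_def by (auto intro: Ck_on_affine[OF assms(1-4)])

lemma smooth_on_det:
  fixes F :: "real^'k::finite \<Rightarrow> real^'n::finite^'n"
  assumes "open U" "\<And>i j. smooth_on U (\<lambda>w. F w $ i $ j)"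
  shows "smooth_on U (\<lambda>w. det (F w))"
  unfolding det_def
  by (intro smooth_on_sum smooth_on_mult smooth_on_prod smooth_on_const assms)

text \<open>Each entry of the adjugate is a determinant whose entries are constants or entries of
  \<open>F\<close>. This makes matrix inverses smooth, as \<open>cof\<close> divided by
  \<open>det\<close>.\<close>

lemma smooth_on_cof:
  fixes F :: "real^'k::finite \<Rightarrow> real^'n::finite^'n"
  assumes "open U" "\<And>i j. smooth_on U (\<lambda>w. F w $ i $ j)"
  shows "smooth_on U (\<lambda>w. cof (F w) $ i $ j)"
  unfolding cof_def vec_lambda_beta
proof (rule smooth_on_det[OF assms(1)])
  show "smooth_on U (\<lambda>w. (\<chi> k l. if l = i then if k = j then 1 else 0 else F w $ k $ l) $ p $ q)" for p q
    by (cases "q = i") (simp_all add: smooth_on_const assms(2))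
qed

lemma smooth_on_matrix_mult:
  fixes F :: "real^'k::finite \<Rightarrow> real^'n::finite^'m::finite" and H :: "real^'k \<Rightarrow> real^'p::finite^'n"
  assumes "open U" "\<And>i j. smooth_on U (\<lambda>w. F w $ i $ j)" "\<And>i j. smooth_on U (\<lambda>w. H w $ i $ j)"
  shows "smooth_on U (\<lambda>w. (F w ** H w) $ i $ j)"
  unfolding matrix_matrix_mult_def vec_lambda_beta
  by (intro smooth_on_sum smooth_on_mult assms)

section \<open>Entrywise differentiation of matrix-valued functions\<close>

definition partial_matrix :: "'k::finite \<Rightarrow> (real^'k \<Rightarrow> real^'n^'m) \<Rightarrow> real^'k \<Rightarrow> real^'n::finite^'m::finite" where
  "partial_matrix k F z = (\<chi> i j. partial k (\<lambda>w. F w $ i $ j) z)"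

lemma partial_matrix_nth [simp]:
  "partial_matrix k F z $ i $ j = partial k (\<lambda>w. F w $ i $ j) z"
  by (simp add: partial_matrix_def)

lemma partial_matrix_cong_open:
  assumes "open U" "z \<in> U" "\<And>w. w \<in> U \<Longrightarrow> F w = H w"
  shows "partial_matrix k F z = partial_matrix k H z"
  unfolding partial_matrix_def using assms by (auto simp: vec_eq_iff intro!: partial_cong_open)

lemma differentiable_matrix_mult:
  fixes F :: "real^'k::finite \<Rightarrow> real^'n::finite^'m::finite" and H :: "real^'k \<Rightarrow> real^'p::finite^'n"
  assumes "\<And>i j. (\<lambda>w. F w $ i $ j) differentiable (at z)" "\<And>i j. (\<lambda>w. H w $ i $ j) differentiable (at z)"
  shows "(\<lambda>w. (F w ** H w) $ i $ j) differentiable (at z)"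
  unfolding matrix_matrix_mult_def vec_lambda_beta
  by (intro differentiable_sum differentiable_mult assms finite ballI)

lemma partial_matrix_mult:
  fixes F :: "real^'k::finite \<Rightarrow> real^'n::finite^'m::finite" and H :: "real^'k \<Rightarrow> real^'p::finite^'n"
  assumes "\<And>i j. (\<lambda>w. F w $ i $ j) differentiable (at z)" "\<And>i j. (\<lambda>w. H w $ i $ j) differentiable (at z)"
  shows "partial_matrix k (\<lambda>w. F w ** H w) z = partial_matrix k F z ** H z + F z ** partial_matrix k H z"
  using assms
  by (simp add: vec_eq_iff matrix_matrix_mult_def partial_sum partial_mult sum.distrib
      differentiable_mult mult.commute add.commute)

lemma partial_diff:
  assumes "f differentiable (at z)" "h differentiable (at z)"
  shows "partial k (\<lambda>w. f w - h w) z = partial k f z - partial k h z"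
proof -
  have "((\<lambda>w. f w - h w) has_derivative
      (\<lambda>v. frechet_derivative f (at z) v - frechet_derivative h (at z) v)) (at z)"
    using assms by (intro has_derivative_diff) (auto simp: frechet_derivative_works)
  from partial_eqI[OF this] show ?thesis by (simp add: partial_def)
qed

lemma partial_matrix_diff:
  assumes "\<And>i j. (\<lambda>w. F w $ i $ j) differentiable (at z)" "\<And>i j. (\<lambda>w. H w $ i $ j) differentiable (at z)"
  shows "partial_matrix k (\<lambda>w. F w - H w) z = partial_matrix k F z - partial_matrix k H z"
  using assms by (simp add: vec_eq_iff partial_diff)

lemma partial_trace:
  fixes F :: "real^'k::finite \<Rightarrow> real^'n::finite^'n"
  assumes "\<And>i j. (\<lambda>w. F w $ i $ j) differentiable (at z)"
  shows "partial k (\<lambda>w. trace (F w)) z = trace (partial_matrix k F z)"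
  using assms by (simp add: trace_def partial_sum)


subsection \<open>Special conformal Killing tensors\<close>

definition christoffel_matrix ::
  "(real^'k::finite \<Rightarrow> real^'k^'k) \<Rightarrow> 'k \<Rightarrow> real^'k \<Rightarrow> real^'k^'k" where
  "christoffel_matrix g \<gamma> z = (\<chi> \<delta> \<alpha>. christoffel g \<delta> \<gamma> \<alpha> z)"

text \<open>For a fixed direction \<gamma> the covariant derivative becomes a matrix expression, so
  that inverses, blocks and traces can be handled without indices.\<close>

lemma cov_deriv2_matrix:
  "cov_deriv2 g T \<alpha> \<beta> \<gamma> z =
   (partial_matrix \<gamma> T z - transpose (christoffel_matrix g \<gamma> z) ** T z
     - T z ** christoffel_matrix g \<gamma> z) $ \<alpha> $ \<beta>"
  by (simp add: cov_deriv2_def christoffel_matrix_def matrix_matrix_mult_def transpose_def mult.commute)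

lemma trace_transpose: "trace (transpose A) = trace A"
  by (simp add: trace_def transpose_def)

lemma riemannian_metric_onD:
  assumes "riemannian_metric_on U g"
  shows "open U" "smooth_on U (\<lambda>w. g w $ \<alpha> $ \<beta>)"
    "z \<in> U \<Longrightarrow> transpose (g z) = g z" "z \<in> U \<Longrightarrow> v \<noteq> 0 \<Longrightarrow> v \<bullet> (g z *v v) > 0"
    "z \<in> U \<Longrightarrow> det (g z) \<noteq> 0" "z \<in> U \<Longrightarrow> transpose (matrix_inv (g z)) = matrix_inv (g z)"
    "z \<in> U \<Longrightarrow> g z $ \<alpha> $ \<beta> = g z $ \<beta> $ \<alpha>"
proof -
  show "open U" "smooth_on U (\<lambda>w. g w $ \<alpha> $ \<beta>)"
    using assms by (auto simp: riemannian_metric_on_def smooth_tensor_on_def)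
  have sym: "transpose (g z) = g z" and pos: "v \<noteq> 0 \<Longrightarrow> v \<bullet> (g z *v v) > 0" if "z \<in> U" for z v
    using assms that by (auto simp: riemannian_metric_on_def)
  have nz: "det (g z) \<noteq> 0" if "z \<in> U" for z
    using pos[OF that] by (rule det_pos_def_nz)
  show "z \<in> U \<Longrightarrow> transpose (g z) = g z" "z \<in> U \<Longrightarrow> v \<noteq> 0 \<Longrightarrow> v \<bullet> (g z *v v) > 0"
    "z \<in> U \<Longrightarrow> det (g z) \<noteq> 0"
    by (fact sym pos nz)+
  show "transpose (matrix_inv (g z)) = matrix_inv (g z)" if "z \<in> U"
    using transpose_matrix_inv[OF nz[OF that]] sym[OF that] by simp
  show "g z $ \<alpha> $ \<beta> = g z $ \<beta> $ \<alpha>" if "z \<in> U"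
    using sym[OF that] by (metis transpose_def vec_lambda_beta)
qed

lemma trace_antisymmetric_mult_symmetric:
  fixes F S :: "real^'k::finite^'k"
  assumes "transpose F = - F" "transpose S = S"
  shows "trace (F ** S) = 0"
proof -
  have "trace (F ** S) = trace (transpose (F ** S))"
    by (simp add: trace_transpose)
  also have "\<dots> = trace (- (S ** F))"
    by (simp add: matrix_transpose_mul assms matrix_mult_uminus_right)
  also have "\<dots> = - trace (F ** S)"
    by (simp add: trace_mul_sym[of F S]) (simp add: trace_def sum_negf)
  finally show ?thesis by simp
qed

text \<open>Metric compatibility in disguise: the Christoffel symbols contribute
  \<open>2 tr (\<Gamma> M) = tr (g\<^sup>-\<^sup>1 (\<partial>g) M)\<close>, because their remaining part is antisymmetric once the
  index is lowered and hence traceless against the symmetric \<open>M g\<^sup>-\<^sup>1\<close>.\<close>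

lemma trace_cov_deriv2:
  assumes g: "riemannian_metric_on U g" and M: "smooth_tensor_on U M" and z: "z \<in> U"
    and sym: "transpose (g z ** M z) = g z ** M z"
  shows "trace (matrix_inv (g z) ** (\<chi> \<alpha> \<beta>. cov_deriv2 g (\<lambda>w. g w ** M w) \<alpha> \<beta> \<gamma> z)) =
    partial \<gamma> (\<lambda>w. trace (M w)) z"
proof -
  note gD = riemannian_metric_onD[OF g]
  define G H D dM C where "G = g z" and "H = matrix_inv (g z)" and "D = partial_matrix \<gamma> g z"
    and "dM = partial_matrix \<gamma> M z" and "C = christoffel_matrix g \<gamma> z"
  \<comment> \<open>\<open>D\<close> is the symmetric and \<open>F\<close> the antisymmetric part of
    twice the Christoffel symbol with its upper index lowered.\<close>
  define F :: "real^'a^'a" where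
    "F = (\<chi> \<epsilon> \<alpha>. partial \<alpha> (\<lambda>w. g w $ \<epsilon> $ \<gamma>) z - partial \<epsilon> (\<lambda>w. g w $ \<gamma> $ \<alpha>) z)"
  have HG: "H ** G = mat 1"
    using matrix_inv_det gD(5) z by (auto simp: G_def H_def)
  have Hsym: "transpose H = H"
    using gD(6) z by (simp add: H_def)
  have dg: "(\<lambda>w. g w $ i $ j) differentiable (at z)" for i j
    using gD(2) z by (rule smooth_on_imp_differentiable)
  have dM': "(\<lambda>w. M w $ i $ j) differentiable (at z)" for i j
    using M z by (auto simp: smooth_tensor_on_def intro: smooth_on_imp_differentiable)
  have "partial_matrix \<gamma> (\<lambda>w. g w ** M w) z = D ** M z + G ** dM"
    using partial_matrix_mult[OF dg dM'] by (simp add: D_def G_def dM_def)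
  then have "(\<chi> \<alpha> \<beta>. cov_deriv2 g (\<lambda>w. g w ** M w) \<alpha> \<beta> \<gamma> z) =
      D ** M z + G ** dM - transpose C ** (G ** M z) - (G ** M z) ** C"
    unfolding cov_deriv2_matrix by (simp only: C_def G_def vec_lambda_eta)
  then have "trace (H ** (\<chi> \<alpha> \<beta>. cov_deriv2 g (\<lambda>w. g w ** M w) \<alpha> \<beta> \<gamma> z)) =
      trace (H ** D ** M z) + trace dM - trace (H ** transpose C ** (G ** M z)) - trace (M z ** C)"
    by (simp add: matrix_ring trace_add trace_sub matrix_mul_assoc HG)
  \<comment> \<open>Since \<open>G ** M z\<close> is symmetric, transposing shows that both
    Christoffel terms have the same trace; they are then merged through
    \<open>C + C\<close>.\<close>
  also have "trace (H ** transpose C ** (G ** M z)) = trace (transpose (H ** transpose C ** (G ** M z)))"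
    by (simp add: trace_transpose)
  also have "transpose (H ** transpose C ** (G ** M z)) = (G ** M z) ** (C ** H)"
    using sym by (subst matrix_transpose_mul) (simp add: G_def matrix_transpose_mul Hsym)
  also have "trace \<dots> = trace (C ** (H ** G) ** M z)"
    by (subst trace_mul_sym) (simp add: matrix_mul_assoc)
  also have "\<dots> = trace (C ** M z)"
    by (simp add: HG)
  also have "trace (M z ** C) = trace (C ** M z)"
    by (rule trace_mul_sym)
  also have "trace (H ** D ** M z) + trace dM - trace (C ** M z) - trace (C ** M z) =
      trace (H ** D ** M z) + trace dM - trace ((C + C) ** M z)"
    unfolding matrix_mult_add_right trace_add by simp
  also have "C + C = H ** (D + F)"
    by (simp add: vec_eq_iff C_def christoffel_matrix_def christoffel_def matrix_matrix_mult_def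
        H_def D_def F_def algebra_simps)
  also have "trace (H ** D ** M z) + trace dM - trace (H ** (D + F) ** M z) =
      trace dM - trace (H ** F ** M z)"
    by (simp add: matrix_ring trace_add)
  also have "trace (H ** F ** M z) = trace (F ** (M z ** H))"
    using trace_mul_sym[of H "F ** M z"] by (simp add: matrix_mul_assoc)
  also have "\<dots> = 0"
  proof (rule trace_antisymmetric_mult_symmetric)
    have "partial \<alpha> (\<lambda>w. g w $ i $ j) z = partial \<alpha> (\<lambda>w. g w $ j $ i) z" for \<alpha> i j
      by (rule partial_cong_open[OF gD(1) z]) (rule gD(7))
    then show "transpose F = - F"
      by (simp add: F_def transpose_def vec_eq_iff)
    \<comment> \<open>Raising both indices of the symmetric \<open>G ** M z\<close> is a congruence
      by the symmetric \<open>H\<close>, hence preserves symmetry.\<close>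
    have "M z ** H = H ** (G ** M z) ** H"
      by (simp add: matrix_mul_assoc HG)
    moreover have "transpose (H ** (G ** M z) ** H) = H ** (G ** M z) ** H"
      using sym by (simp only: G_def matrix_transpose_mul[of "H ** (g z ** M z)" H]
          matrix_transpose_mul[of H "g z ** M z"] Hsym) (simp only: matrix_mul_assoc)
    ultimately show "transpose (M z ** H) = M z ** H"
      by simp
  qed
  finally show ?thesis
    by (simp add: H_def dM_def partial_trace[OF dM'])
qed

text \<open>The one-form on the right-hand side of the defining equation is necessarily \<open>d (tr M)\<close>.\<close>

lemma sckt_onI:
  assumes g: "riemannian_metric_on U g" and M: "smooth_tensor_on U M"
    and sym: "\<And>z. z \<in> U \<Longrightarrow> transpose (g z ** M z) = g z ** M z"
    and cov: "\<And>z. z \<in> U \<Longrightarrow> \<exists>b. \<forall>\<alpha> \<beta> \<gamma>. cov_deriv2 g (\<lambda>w. g w ** M w) \<alpha> \<beta> \<gamma> z =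
      (b \<alpha> * g z $ \<beta> $ \<gamma> + b \<beta> * g z $ \<alpha> $ \<gamma>) / 2"
  shows "sckt_on U g M"
proof -
  have "cov_deriv2 g (\<lambda>w. g w ** M w) \<alpha> \<beta> \<gamma> z =
      (d0 (\<lambda>w. trace (M w)) z $ \<alpha> * g z $ \<beta> $ \<gamma> + d0 (\<lambda>w. trace (M w)) z $ \<beta> * g z $ \<alpha> $ \<gamma>) / 2"
    if z: "z \<in> U" for z \<alpha> \<beta> \<gamma>
  proof -
    obtain b where b: "\<And>\<alpha> \<beta> \<gamma>. cov_deriv2 g (\<lambda>w. g w ** M w) \<alpha> \<beta> \<gamma> z =
      (b \<alpha> * g z $ \<beta> $ \<gamma> + b \<beta> * g z $ \<alpha> $ \<gamma>) / 2"
      using cov[OF z] by blast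
    define H where "H = matrix_inv (g z)"
    note gD = riemannian_metric_onD[OF g]
    have Hsym: "H $ i $ j = H $ j $ i" for i j
      using gD(6)[OF z] by (metis H_def transpose_def vec_lambda_beta)
    have HG: "(\<Sum>j\<in>UNIV. H $ i $ j * g z $ j $ \<gamma>) = of_bool (i = \<gamma>)" for i \<gamma>
    proof -
      have "(H ** g z) $ i $ \<gamma> = of_bool (i = \<gamma>)"
        using matrix_inv_det(2)[OF gD(5)[OF z]] by (simp add: H_def mat_def)
      then show ?thesis by (simp add: matrix_matrix_mult_def)
    qed
    have "d0 (\<lambda>w. trace (M w)) z $ \<gamma> = b \<gamma>" for \<gamma>
    proof -
      have "d0 (\<lambda>w. trace (M w)) z $ \<gamma> =
          trace (H ** (\<chi> \<alpha> \<beta>. (b \<alpha> * g z $ \<beta> $ \<gamma> + b \<beta> * g z $ \<alpha> $ \<gamma>) / 2))"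
        using trace_cov_deriv2[OF g M z sym[OF z], of \<gamma>] by (simp add: d0_def H_def b)
      \<comment> \<open>Contraction with the inverse metric turns each summand into half of
        \<open>b \<gamma>\<close>; the symmetry of \<open>H\<close> first brings both to the same
        shape.\<close>
      also have "\<dots> = (\<Sum>i\<in>UNIV. \<Sum>j\<in>UNIV. H $ i $ j * (b j * g z $ i $ \<gamma>) / 2) +
          (\<Sum>i\<in>UNIV. \<Sum>j\<in>UNIV. H $ i $ j * (b i * g z $ j $ \<gamma>) / 2)"
        by (simp add: trace_def matrix_matrix_mult_def sum.distrib[symmetric] algebra_simps add_divide_distrib)
      also have "(\<Sum>i\<in>UNIV. \<Sum>j\<in>UNIV. H $ i $ j * (b j * g z $ i $ \<gamma>) / 2) =
          (\<Sum>j\<in>UNIV. \<Sum>i\<in>UNIV. H $ j $ i * (b j * g z $ i $ \<gamma>) / 2)"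
        by (subst sum.swap) (simp only: Hsym)
      also have "\<dots> + (\<Sum>i\<in>UNIV. \<Sum>j\<in>UNIV. H $ i $ j * (b i * g z $ j $ \<gamma>) / 2) =
          (\<Sum>i\<in>UNIV. b i * (\<Sum>j\<in>UNIV. H $ i $ j * g z $ j $ \<gamma>))"
        by (simp add: sum.distrib[symmetric] sum_distrib_left mult_ac)
      also have "\<dots> = b \<gamma>"
        by (simp add: HG)
      finally show ?thesis .
    qed
    then show ?thesis by (simp add: b)
  qed
  then show ?thesis
    using g M sym by (simp add: sckt_on_def)
qed

section \<open>The Schur complement: smoothness, symmetry, derivative\<close>

lemma J2bar_eq_blocks:
  "J2bar T = restrict_K T - block21 T ** matrix_inv (restrict_Kperp T) ** block12 T"
  by (metis J2bar_block block_matrix_collapse)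

text \<open>On the open set \<open>V\<close>, where the determinant of the leading block does not
  vanish, its inverse may be traded for the adjugate formula.\<close>

lemma smooth_J2bar:
  fixes T :: "real^'k::finite \<Rightarrow> real^('m::finite + 'n::finite)^('m + 'n)"
  assumes V: "open V" and T: "\<And>\<alpha> \<beta>. smooth_on V (\<lambda>w. T w $ \<alpha> $ \<beta>)"
    and nz: "\<And>w. w \<in> V \<Longrightarrow> det (restrict_Kperp (T w)) \<noteq> 0"
  shows "smooth_on V (\<lambda>w. matrix_inv (restrict_Kperp (T w)) $ i $ j)"
    and "smooth_on V (\<lambda>w. J2bar (T w) $ a $ b)"
proof -
  have R: "smooth_on V (\<lambda>w. restrict_Kperp (T w) $ i $ j)" "smooth_on V (\<lambda>w. block12 (T w) $ i $ b)"
    "smooth_on V (\<lambda>w. block21 (T w) $ a $ j)" "smooth_on V (\<lambda>w. restrict_K (T w) $ a $ b)" for i j a b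
    by (simp_all add: restrict_Kperp_def restrict_K_def block12_def block21_def T)
  show inv: "smooth_on V (\<lambda>w. matrix_inv (restrict_Kperp (T w)) $ i $ j)" for i j
  proof (subst smooth_on_cong[OF V])
    show "matrix_inv (restrict_Kperp (T w)) $ i $ j =
        inverse (det (restrict_Kperp (T w))) * cof (restrict_Kperp (T w)) $ i $ j" if "w \<in> V" for w
      by (simp add: matrix_inv_cof nz that)
    show "smooth_on V (\<lambda>w. inverse (det (restrict_Kperp (T w))) * cof (restrict_Kperp (T w)) $ i $ j)"
      by (intro smooth_on_mult smooth_on_inverse smooth_on_det smooth_on_cof V R nz)
  qed
  show "smooth_on V (\<lambda>w. J2bar (T w) $ a $ b)"
    unfolding J2bar_eq_blocks vector_minus_component
    by (intro smooth_on_diff smooth_on_matrix_mult V R inv)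
qed

text \<open>In the product of the three blocks \<open>G1\<close> meets its own inverse and cancels.
  Lowering an index with a block diagonal metric therefore commutes with taking the Schur
  complement.\<close>

lemma J2bar_block_diag_mult:
  fixes T :: "real^('m::finite + 'n::finite)^('m + 'n)"
  assumes "det G1 \<noteq> 0" "det (J1 T) \<noteq> 0"
  shows "J2bar (block_matrix G1 0 0 G2 ** T) = G2 ** J2bar T"
    and "det (restrict_Kperp (block_matrix G1 0 0 G2 ** T)) \<noteq> 0"
proof -
  obtain A B C D where T: "T = block_matrix A B C D"
    by (metis block_matrix_collapse)
  have A: "det A \<noteq> 0" using assms(2) by (simp add: T)
  have "matrix_inv (G1 ** A) = matrix_inv A ** matrix_inv G1"
  proof (rule matrix_inv_unique_right)
    have "G1 ** A ** (matrix_inv A ** matrix_inv G1) = G1 ** (A ** matrix_inv A) ** matrix_inv G1"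
      by (simp add: matrix_mul_assoc)
    then show "G1 ** A ** (matrix_inv A ** matrix_inv G1) = mat 1"
      by (simp add: matrix_inv_det A assms(1))
  qed
  moreover have "G2 ** C ** (matrix_inv A ** matrix_inv G1) ** (G1 ** B) =
      G2 ** C ** matrix_inv A ** (matrix_inv G1 ** G1) ** B"
    by (simp add: matrix_mul_assoc)
  ultimately show "J2bar (block_matrix G1 0 0 G2 ** T) = G2 ** J2bar T"
    by (simp add: T block_matrix_mult J2bar_block matrix_ring matrix_inv_det assms(1))
      (simp add: matrix_mul_assoc)
  show "det (restrict_Kperp (block_matrix G1 0 0 G2 ** T)) \<noteq> 0"
    by (simp add: T block_matrix_mult det_mul assms(1) A)
qed

lemma transpose_J2bar:
  assumes "transpose T = T" "det (restrict_Kperp T) \<noteq> 0"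
  shows "transpose (J2bar T) = J2bar T"
    and "transpose (matrix_inv (restrict_Kperp T)) = matrix_inv (restrict_Kperp T)"
    and "transpose (block12 T) = block21 T"
proof -
  obtain A B C D where T: "T = block_matrix A B C D"
    by (metis block_matrix_collapse)
  have sym: "transpose A = A" "transpose C = B" "transpose B = C" "transpose D = D"
    using assms(1) by (simp_all add: T transpose_block_matrix block_matrix_eq_iff)
  have "transpose (matrix_inv A) = matrix_inv A"
    using transpose_matrix_inv[of A] assms(2) sym by (simp add: T)
  moreover have "transpose (X - Y) = transpose X - transpose Y" for X Y :: "real^'b^'b"
    by (simp add: transpose_def vec_eq_iff)
  ultimately show "transpose (J2bar T) = J2bar T"
    "transpose (matrix_inv (restrict_Kperp T)) = matrix_inv (restrict_Kperp T)"
    "transpose (block12 T) = block21 T"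
    using sym by (simp_all add: T J2bar_block matrix_transpose_mul matrix_mul_assoc)
qed

text \<open>When the leading block is stationary, so is its inverse, and only the other three blocks
  contribute to the derivative of the Schur complement.\<close>

lemma partial_matrix_J2bar:
  fixes T :: "real^'k::finite \<Rightarrow> real^('m::finite + 'n::finite)^('m + 'n)"
  assumes V: "open V" "x \<in> V" and T: "\<And>\<alpha> \<beta>. smooth_on V (\<lambda>w. T w $ \<alpha> $ \<beta>)"
    and nz: "\<And>w. w \<in> V \<Longrightarrow> det (restrict_Kperp (T w)) \<noteq> 0"
    and stationary: "restrict_Kperp (partial_matrix c T x) = 0"
  shows "partial_matrix c (\<lambda>w. J2bar (T w)) x = restrict_K (partial_matrix c T x)
      - block21 (partial_matrix c T x) ** matrix_inv (restrict_Kperp (T x)) ** block12 (T x)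
      - block21 (T x) ** matrix_inv (restrict_Kperp (T x)) ** block12 (partial_matrix c T x)"
proof -
  define R where "R w = matrix_inv (restrict_Kperp (T w))" for w
  have dT: "(\<lambda>w. T w $ \<alpha> $ \<beta>) differentiable (at x)" for \<alpha> \<beta>
    using T V(2) by (rule smooth_on_imp_differentiable)
  then have d: "(\<lambda>w. restrict_Kperp (T w) $ i $ j) differentiable (at x)"
    "(\<lambda>w. block12 (T w) $ i $ b) differentiable (at x)"
    "(\<lambda>w. block21 (T w) $ a $ j) differentiable (at x)"
    "(\<lambda>w. restrict_K (T w) $ a $ b) differentiable (at x)" for i j a b
    by (simp_all add: restrict_Kperp_def restrict_K_def block12_def block21_def)
  have dR: "(\<lambda>w. R w $ i $ j) differentiable (at x)" for i j
    using smooth_J2bar(1)[OF V(1) T nz] V(2) unfolding R_def by (rule smooth_on_imp_differentiable)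
  have p: "partial_matrix c (\<lambda>w. restrict_Kperp (T w)) x = restrict_Kperp (partial_matrix c T x)"
    "partial_matrix c (\<lambda>w. block12 (T w)) x = block12 (partial_matrix c T x)"
    "partial_matrix c (\<lambda>w. block21 (T w)) x = block21 (partial_matrix c T x)"
    "partial_matrix c (\<lambda>w. restrict_K (T w)) x = restrict_K (partial_matrix c T x)"
    by (simp_all add: vec_eq_iff restrict_Kperp_def restrict_K_def block12_def block21_def)
  \<comment> \<open>The inverse is differentiated through the identity it satisfies. With a
    stationary leading block, what remains is the derivative of \<open>R\<close> times an invertible
    matrix.\<close>
  have "partial_matrix c (\<lambda>w. R w ** restrict_Kperp (T w)) x = partial_matrix c (\<lambda>w. mat 1) x"
    by (rule partial_matrix_cong_open[OF V]) (simp add: R_def matrix_inv_det nz)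
  then have "partial_matrix c R x ** restrict_Kperp (T x) = 0"
    by (simp add: partial_matrix_mult[OF dR d(1)] p stationary)
      (simp add: vec_eq_iff partial_const)
  then have "partial_matrix c R x ** (restrict_Kperp (T x) ** R x) = 0"
    by (simp add: matrix_mul_assoc)
  then have "partial_matrix c R x = 0"
    by (simp add: R_def matrix_inv_det nz V)
  then show ?thesis
    unfolding J2bar_eq_blocks R_def[symmetric]
    by (simp add: partial_matrix_diff partial_matrix_mult differentiable_matrix_mult d dR p matrix_ring)
qed


subsection \<open>Block diagonal metrics\<close>

lemma join_parts [simp]:
  "y_part (join y x) = y" "x_part (join y x) = x" "join (y_part z) (x_part z) = z"
  by (simp_all add: join_def y_part_def x_part_def vec_eq_iff forall_sum_index)

lemma join_add: "join y 0 + join 0 x = join y x"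
  by (simp add: join_def vec_eq_iff forall_sum_index)

text \<open>Each slice embedding is a constant plus a linear map. The images of basis vectors are
  recorded in the form that \<open>partial_chain_affine\<close> requires.\<close>

lemma join_derivative:
  fixes x :: "real^'n::finite" and y :: "real^'m::finite"
  shows "((\<lambda>x. join y x) has_derivative (\<lambda>x. join 0 x)) (at x)"
    and "((\<lambda>y. join y x) has_derivative (\<lambda>y. join y 0)) (at y)"
    and "join 0 (axis a 1) = (axis (Inr a) 1 :: real^('m + 'n))"
    and "join (axis i 1) 0 = (axis (Inl i) 1 :: real^('m + 'n))"
proof -
  have "linear (\<lambda>x. join 0 x :: real^('m + 'n))" "linear (\<lambda>y. join y 0 :: real^('m + 'n))"
    by (auto intro!: linearI simp: join_def vec_eq_iff split: sum.split)
  then have 1: "((\<lambda>x. join 0 x :: real^('m + 'n)) has_derivative (\<lambda>x. join 0 x)) (at x)"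
    and 2: "((\<lambda>y. join y 0 :: real^('m + 'n)) has_derivative (\<lambda>y. join y 0)) (at y)"
    by (auto intro: linear_imp_has_derivative)
  show "((\<lambda>x. join y x) has_derivative (\<lambda>x. join 0 x)) (at x)"
    using has_derivative_add[OF has_derivative_const[of "join y 0"] 1]
    by (simp only: join_add add_0)
  show "((\<lambda>y. join y x) has_derivative (\<lambda>y. join y 0)) (at y)"
    using has_derivative_add[OF 2 has_derivative_const[of "join 0 x"]]
    by (simp only: join_add add_0_right)
  show "join 0 (axis a 1) = (axis (Inr a) 1 :: real^('m + 'n))"
    "join (axis i 1) 0 = (axis (Inl i) 1 :: real^('m + 'n))"
    by (simp_all add: join_def axis_def vec_eq_iff forall_sum_index)
qed

lemma open_slices:
  assumes "open U"
  shows "open {x. join y x \<in> U}" "open {y. join y x \<in> U}"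
proof -
  have "continuous_on UNIV (\<lambda>x. join y x)" "continuous_on UNIV (\<lambda>y. join y x)"
    using has_derivative_continuous[OF join_derivative(1)] has_derivative_continuous[OF join_derivative(2)]
    by (auto intro!: continuous_at_imp_continuous_on)
  from this[THEN continuous_open_preimage, OF open_UNIV assms]
  show "open {x. join y x \<in> U}" "open {y. join y x \<in> U}"
    by (simp_all add: vimage_def)
qed

lemma smooth_on_slice:
  assumes "open U" "smooth_on U f"
  shows "smooth_on {x. join y x \<in> U} (\<lambda>x. f (join y x))"
  by (rule smooth_on_affine[OF open_slices(1)[OF assms(1)] _ join_derivative(1,3) assms(2)]) simp

lemma partial_slice:
  assumes "f differentiable (at (join y x))"
  shows "partial a (\<lambda>x. f (join y x)) x = partial (Inr a) f (join y x)"
    and "partial i (\<lambda>y. f (join y x)) y = partial (Inl i) f (join y x)"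
  by (rule partial_chain_affine[OF join_derivative(1,3) assms],
      rule partial_chain_affine[OF join_derivative(2,4) assms])

section \<open>Block diagonal metrics and their restriction to slices\<close>

locale product_metric =
  fixes U :: "(real^('m::finite + 'n::finite)) set"
    and g1 :: "real^'m \<Rightarrow> real^'m^'m"
    and g2 :: "real^'n \<Rightarrow> real^'n^'n"
    and g :: "real^('m + 'n) \<Rightarrow> real^('m + 'n)^('m + 'n)"
  assumes metric: "riemannian_metric_on U g"
    and g_join: "join y x \<in> U \<Longrightarrow> g (join y x) = block_matrix (g1 y) 0 0 (g2 x)"
begin

lemmas gD = riemannian_metric_onD[OF metric]

lemma slice_metric: "riemannian_metric_on {x. join y x \<in> U} g2"
proof -
  have "smooth_on {x. join y x \<in> U} (\<lambda>x. g2 x $ a $ b)" for a b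
    using smooth_on_slice[OF gD(1,2), of y "Inr a" "Inr b"]
    by (rule smooth_on_cong[THEN iffD1, rotated 2]) (simp_all add: open_slices gD(1) g_join)
  moreover have "transpose (g2 x) = g2 x" if "join y x \<in> U" for x
    using gD(3)[OF that] by (simp add: g_join that transpose_block_matrix block_matrix_eq_iff)
  moreover have "v \<bullet> (g2 x *v v) > 0" if "join y x \<in> U" "v \<noteq> 0" for x v
  proof -
    \<comment> \<open>Positivity of \<open>g\<close> is tested on vectors tangent to the slice,
      where only the block \<open>g2\<close> contributes.\<close>
    have "join 0 v \<noteq> (0 :: real^('m + 'n))"
      using that(2) by (auto simp: join_def vec_eq_iff forall_sum_index)
    then have "join 0 v \<bullet> (g (join y x) *v join 0 v) > 0"
      using gD(4) that(1) by blast
    also have "join 0 v \<bullet> (g (join y x) *v join 0 v) =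
        join 0 v \<bullet> (block_matrix (g1 y) 0 0 (g2 x) *v join 0 v)"
      by (simp add: g_join that(1))
    also have "\<dots> = v \<bullet> (g2 x *v v)"
      by (simp add: inner_vec_def matrix_vector_mult_def sum_sum_index join_def)
    finally show ?thesis .
  qed
  ultimately show ?thesis
    by (auto simp: riemannian_metric_on_def smooth_tensor_on_def open_slices gD(1))
qed

lemma det_nz:
  assumes "join y x \<in> U"
  shows "det (g1 y) \<noteq> 0" "det (g2 x) \<noteq> 0"
  using gD(5)[OF assms] by (auto simp: g_join assms det_block_diag)

lemma matrix_inv_g:
  assumes "join y x \<in> U"
  shows "matrix_inv (g (join y x)) = block_matrix (matrix_inv (g1 y)) 0 0 (matrix_inv (g2 x))"
  by (rule matrix_inv_unique_right)
    (simp add: g_join assms block_matrix_mult matrix_inv_det det_nz[OF assms] block_matrix_one)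

text \<open>These are the derivatives that enter a Christoffel symbol with a lower
  \<open>x\<close>-index, which occurs either as the direction of differentiation or as an index of
  the metric.\<close>

lemma partial_g:
  assumes z: "join y x \<in> U"
  shows "partial (Inr c) (\<lambda>w. g w $ Inr a $ Inr b) (join y x) = partial c (\<lambda>x. g2 x $ a $ b) x"
    and "partial (Inr c) (\<lambda>w. g w $ Inl i $ Inl j) (join y x) = 0"
    and "partial (Inl k) (\<lambda>w. g w $ Inr a $ Inr b) (join y x) = 0"
    and "partial \<gamma> (\<lambda>w. g w $ Inl i $ Inr b) (join y x) = 0"
    and "partial \<gamma> (\<lambda>w. g w $ Inr a $ Inl j) (join y x) = 0"
proof -
  have d: "(\<lambda>w. g w $ \<alpha> $ \<beta>) differentiable (at (join y x))" for \<alpha> \<beta>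
    using gD(2) z by (rule smooth_on_imp_differentiable)
  have xs: "partial (Inr c) (\<lambda>w. g w $ \<alpha> $ \<beta>) (join y x) =
      partial c (\<lambda>x. block_matrix (g1 y) 0 0 (g2 x) $ \<alpha> $ \<beta>) x" for \<alpha> \<beta>
    unfolding partial_slice(1)[OF d, symmetric]
    by (rule partial_cong_open[OF open_slices(1)[OF gD(1), where y = y]]) (simp_all add: z g_join)
  have ys: "partial (Inl k) (\<lambda>w. g w $ \<alpha> $ \<beta>) (join y x) =
      partial k (\<lambda>y. block_matrix (g1 y) 0 0 (g2 x) $ \<alpha> $ \<beta>) y" for \<alpha> \<beta> k
    unfolding partial_slice(2)[OF d, symmetric]
    by (rule partial_cong_open[OF open_slices(2)[OF gD(1), where x = x]]) (simp_all add: z g_join)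
  show "partial (Inr c) (\<lambda>w. g w $ Inr a $ Inr b) (join y x) = partial c (\<lambda>x. g2 x $ a $ b) x"
    "partial (Inr c) (\<lambda>w. g w $ Inl i $ Inl j) (join y x) = 0"
    "partial (Inl k) (\<lambda>w. g w $ Inr a $ Inr b) (join y x) = 0"
    by (simp_all add: xs ys partial_const)
  have zero: "g w $ Inl i $ Inr b = 0" "g w $ Inr a $ Inl j = 0" if "w \<in> U" for w
    using g_join[of "y_part w" "x_part w"] that by simp_all
  have "partial \<gamma> (\<lambda>w. g w $ Inl i $ Inr b) (join y x) = partial \<gamma> (\<lambda>w. 0) (join y x)"
    "partial \<gamma> (\<lambda>w. g w $ Inr a $ Inl j) (join y x) = partial \<gamma> (\<lambda>w. 0) (join y x)"
    by (rule partial_cong_open[OF gD(1) z], simp add: zero)+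
  then show "partial \<gamma> (\<lambda>w. g w $ Inl i $ Inr b) (join y x) = 0"
    "partial \<gamma> (\<lambda>w. g w $ Inr a $ Inl j) (join y x) = 0"
    by (simp_all add: partial_const)
qed

lemma christoffel_matrix_g:
  assumes z: "join y x \<in> U"
  shows "christoffel_matrix g (Inr c) (join y x) = block_matrix 0 0 0 (christoffel_matrix g2 c x)"
  by (simp add: vec_eq_iff forall_sum_index christoffel_matrix_def christoffel_def sum_sum_index
      matrix_inv_g[OF z] partial_g[OF z])

lemma slice_sckt:
  assumes J: "sckt_on U g J" and nz: "\<And>z. z \<in> U \<Longrightarrow> det (J1 (J z)) \<noteq> 0"
  shows "sckt_on {x. join y x \<in> U} g2 (\<lambda>x. J2bar (J (join y x)))"
proof (rule sckt_onI)
  define V where "V = {x. join y x \<in> U}"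
  define T where "T x = g (join y x) ** J (join y x)" for x
  have V: "open V" using open_slices gD(1) by (simp add: V_def)
  have smooth_J: "smooth_on U (\<lambda>w. J w $ \<alpha> $ \<beta>)" for \<alpha> \<beta>
    using J by (simp add: sckt_on_def smooth_tensor_on_def)
  have T_eq: "J2bar (T x) = g2 x ** J2bar (J (join y x))"
    and T_nz: "det (restrict_Kperp (T x)) \<noteq> 0" if "x \<in> V" for x
    using that J2bar_block_diag_mult[OF det_nz(1)[of y x] nz[of "join y x"]]
    by (simp_all add: V_def T_def g_join)
  have T_sym: "transpose (T x) = T x" if "x \<in> V" for x
    using that J by (auto simp: V_def T_def sckt_on_def)
  have smooth_T: "smooth_on V (\<lambda>x. T x $ \<alpha> $ \<beta>)" for \<alpha> \<beta>
    unfolding V_def T_def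
    by (intro smooth_on_slice[of U "\<lambda>z. (g z ** J z) $ \<alpha> $ \<beta>"] smooth_on_matrix_mult gD smooth_J)
  show "riemannian_metric_on {x. join y x \<in> U} g2"
    by (rule slice_metric)
  show "smooth_tensor_on {x. join y x \<in> U} (\<lambda>x. J2bar (J (join y x)))"
    unfolding smooth_tensor_on_def V_def[symmetric]
  proof (intro allI smooth_J2bar(2) V)
    show "smooth_on V (\<lambda>x. J (join y x) $ \<alpha> $ \<beta>)" for \<alpha> \<beta>
      unfolding V_def by (intro smooth_on_slice[of U "\<lambda>z. J z $ \<alpha> $ \<beta>"] gD smooth_J)
    show "det (restrict_Kperp (J (join y x))) \<noteq> 0" if "x \<in> V" for x
      using nz[of "join y x"] that by (metis V_def J1_block block_matrix_collapse mem_Collect_eq)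
  qed
  show "transpose (g2 x ** J2bar (J (join y x))) = g2 x ** J2bar (J (join y x))"
    if "x \<in> {x. join y x \<in> U}" for x
    using that T_eq transpose_J2bar(1)[OF T_sym T_nz] by (simp add: V_def)
  show "\<exists>b. \<forall>\<alpha> \<beta> \<gamma>. cov_deriv2 g2 (\<lambda>w. g2 w ** J2bar (J (join y w))) \<alpha> \<beta> \<gamma> x =
      (b \<alpha> * g2 x $ \<beta> $ \<gamma> + b \<beta> * g2 x $ \<alpha> $ \<gamma>) / 2" if "x \<in> {x. join y x \<in> U}" for x
  proof -
    have z: "join y x \<in> U" and x: "x \<in> V" using that by (auto simp: V_def)
    define \<alpha>' where "\<alpha>' = d0 (\<lambda>w. trace (J w)) (join y x)"
    define R where "R = matrix_inv (restrict_Kperp (T x))"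
    \<comment> \<open>The mixed blocks of the Killing equation are half of
      \<open>\<alpha>' $ Inl i\<close> times \<open>g2\<close>. Their share in the derivative of the
      Schur complement is the one-form \<open>p\<close>, and the \<open>x\<close>-components of
      \<alpha>' minus \<open>p\<close> form the witness \<open>b\<close>.\<close>
    define p where "p a = (\<Sum>i\<in>UNIV. (block21 (T x) ** R) $ a $ i * \<alpha>' $ Inl i)" for a
    \<comment> \<open>By the symmetry of \<open>T x\<close> both correction terms of the Schur
      complement lead to the same \<open>p\<close>.\<close>
    have RT: "(R ** block12 (T x)) $ i $ a = (block21 (T x) ** R) $ a $ i" for i a
    proof -
      have "R ** block12 (T x) = transpose (block21 (T x) ** R)"
        using transpose_J2bar(2,3)[OF T_sym[OF x] T_nz[OF x]]
        by (simp add: matrix_transpose_mul R_def) (metis transpose_transpose)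
      then show ?thesis by (simp add: transpose_def)
    qed
    have "cov_deriv2 g2 (\<lambda>w. g2 w ** J2bar (J (join y w))) a b c x =
        ((\<alpha>' $ Inr a - p a) * g2 x $ b $ c + (\<alpha>' $ Inr b - p b) * g2 x $ a $ c) / 2" for a b c
    proof -
      define N where "N = (\<chi> \<alpha> \<beta>. cov_deriv2 g (\<lambda>w. g w ** J w) \<alpha> \<beta> (Inr c) (join y x))"
      define K where "K = christoffel_matrix g2 c x"
      define P where "P = partial_matrix c T x"
      have N_nth: "N $ \<alpha> $ \<beta> =
          (\<alpha>' $ \<alpha> * g (join y x) $ \<beta> $ Inr c + \<alpha>' $ \<beta> * g (join y x) $ \<alpha> $ Inr c) / 2" for \<alpha> \<beta>
        using J z by (simp add: N_def sckt_on_def \<alpha>'_def)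
      have "(\<lambda>w. (g w ** J w) $ \<alpha> $ \<beta>) differentiable (at (join y x))" for \<alpha> \<beta>
        using smooth_on_matrix_mult[OF gD(1,2) smooth_J] z by (rule smooth_on_imp_differentiable)
      from partial_slice(1)[OF this]
      have "partial_matrix (Inr c) (\<lambda>w. g w ** J w) (join y x) = P"
        by (simp add: P_def T_def vec_eq_iff)
      then have "N = P - transpose (block_matrix 0 0 0 K) ** T x - T x ** block_matrix 0 0 0 K"
        unfolding N_def cov_deriv2_matrix
        by (simp only: christoffel_matrix_g[OF z] K_def T_def vec_lambda_eta)
      also have "\<dots> = block_matrix (restrict_Kperp P) (block12 P - block12 (T x) ** K)
          (block21 P - transpose K ** block21 (T x))
          (restrict_K P - transpose K ** restrict_K (T x) - restrict_K (T x) ** K)"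
        (is "_ = ?B")
      proof -
        have "block_matrix A B C D - block_matrix A' B' C' D' =
          block_matrix (A - A') (B - B') (C - C') (D - D')"
          for A A' :: "real^'m^'m" and B B' C C' and D D' :: "real^'n^'n"
          by (simp add: vec_eq_iff forall_sum_index)
        then show ?thesis
          by (subst (1) block_matrix_collapse[of P, symmetric],
              subst (1 2) block_matrix_collapse[of "T x", symmetric])
            (simp add: transpose_block_matrix block_matrix_mult)
      qed
      finally have N: "N = ?B" .
      \<comment> \<open>The right-hand side of the Killing equation along \<open>Inr c\<close>
        contains only mixed metric entries in this block, and these vanish. No connection term
        appears there, so the block is stationary.\<close>
      have N11: "restrict_Kperp P = 0"
      proof -
        have "restrict_Kperp N = 0"
          by (simp add: vec_eq_iff restrict_Kperp_def N_nth g_join z)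
        then show ?thesis by (simp add: N)
      qed
      have "partial_matrix c (\<lambda>w. g2 w ** J2bar (J (join y w))) x = partial_matrix c (\<lambda>w. J2bar (T w)) x"
        by (rule partial_matrix_cong_open[OF V x]) (simp add: T_eq)
      also have "\<dots> = restrict_K P - block21 P ** R ** block12 (T x) - block21 (T x) ** R ** block12 P"
        using partial_matrix_J2bar[OF V x smooth_T T_nz] N11 by (simp add: P_def R_def)
      finally have "cov_deriv2 g2 (\<lambda>w. g2 w ** J2bar (J (join y w))) a b c x =
          (restrict_K P - block21 P ** R ** block12 (T x) - block21 (T x) ** R ** block12 P
            - transpose K ** J2bar (T x) - J2bar (T x) ** K) $ a $ b"
        by (simp add: cov_deriv2_matrix K_def T_eq x)
      \<comment> \<open>Each \<open>x\<close>-index of a block of \<open>N\<close> carries one term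
        with \<open>K\<close>. These terms combine into the two connection terms of the Schur
        complement, so \<open>P\<close> and \<open>K\<close> can be eliminated in favour of
        \<open>N\<close>.\<close>
      also have "restrict_K P - block21 P ** R ** block12 (T x) - block21 (T x) ** R ** block12 P
            - transpose K ** J2bar (T x) - J2bar (T x) ** K =
          restrict_K N - block21 N ** (R ** block12 (T x)) - block21 (T x) ** R ** block12 N"
        by (simp add: N J2bar_eq_blocks R_def[symmetric] matrix_ring matrix_mul_assoc)
      also have "\<dots> $ a $ b = N $ Inr a $ Inr b
          - (\<Sum>i\<in>UNIV. N $ Inr a $ Inl i * (R ** block12 (T x)) $ i $ b)
          - (\<Sum>i\<in>UNIV. (block21 (T x) ** R) $ a $ i * N $ Inl i $ Inr b)"
      proof -
        have "(X ** Y) $ a $ b = (\<Sum>i\<in>UNIV. X $ a $ i * Y $ i $ b)"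
          for X :: "real^'m^'n" and Y :: "real^'n^'m"
          by (simp add: matrix_matrix_mult_def)
        then show ?thesis
          by (simp only: vector_minus_component)
            (simp add: restrict_K_def block12_def[of N] block21_def[of N])
      qed
      also have "\<dots> = ((\<alpha>' $ Inr a - p a) * g2 x $ b $ c + (\<alpha>' $ Inr b - p b) * g2 x $ a $ c) / 2"
        by (simp add: N_nth g_join z RT p_def sum_distrib_left sum_distrib_right sum_divide_distrib
            algebra_simps diff_divide_distrib add_divide_distrib)
      finally show ?thesis .
    qed
    then show ?thesis
      by (intro exI[of _ "\<lambda>a. \<alpha>' $ Inr a - p a"] allI)
  qed
qed

end

section \<open>Driven cofactor systems: the Killing property and the cofactor tensor\<close>

theorem proposition1:
  fixes U :: "(real^('m::finite + 'n::finite)) set"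
    and g1 :: "real^'m \<Rightarrow> real^'m^'m"
    and g2 :: "real^'n \<Rightarrow> real^'n^'n"
    and g :: "real^('m + 'n) \<Rightarrow> real^('m + 'n)^('m + 'n)"
    and \<mu> :: "real^('m + 'n) \<Rightarrow> real^('m + 'n)"
    and J :: "real^('m + 'n) \<Rightarrow> real^('m + 'n)^('m + 'n)"
  assumes "driven_cofactor_system U g1 g2 g \<mu> J"
    and "\<And>z. z \<in> U \<Longrightarrow> det (J z) \<noteq> 0"
    and "\<And>z. z \<in> U \<Longrightarrow> det (J1 (J z)) \<noteq> 0"
  shows "(\<forall>y. sckt_on {x. join y x \<in> U} g2 (\<lambda>x. J2bar (J (join y x)))) \<and>
         (\<forall>z\<in>U. cof (J2bar (J z)) = inverse (det (J1 (J z))) *\<^sub>R restrict_K (P2 ** cof (J z) ** P2))"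
proof -
  have J: "sckt_on U g J"
    using assms(1) by (simp add: driven_cofactor_system_def cofactor_system_def)
  interpret product_metric U g1 g2 g
  proof
    show "riemannian_metric_on U g"
      using J by (simp add: sckt_on_def)
    show "g (join y x) = block_matrix (g1 y) 0 0 (g2 x)" if "join y x \<in> U" for x y
      using assms(1) that
      by (simp add: driven_cofactor_system_def vec_eq_iff forall_sum_index)
  qed
  show ?thesis
    using slice_sckt[OF J assms(3)] cof_J2bar[OF assms(2,3)] by blast
qed

end
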